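(* Let $p,n$ be positive integers with $p\ge n-1\ge 5$, and let $p=k(n-1)+r$ with $k$ a positive integer and $r\in\{0,1,\ldots,n-2\}$. Then $$ex(p;T_n^* )=\begin{cases}\frac{(k-1)(n-1)(n-2)}{2}+ex(n-1+r;T_n^* ) & \text{if } 1\le r\le n-5,\\[4pt] \frac{(n-2)p-r(n-1-r)}{2} & \text{if } r\in\{0,n-4,n-3,n-2\}.\end{cases}$$
   Context: All graphs are finite simple graphs. For $n\ge 4$, $T_n^*$ denotes the tree on the $n$ vertices $v_0,v_1,\ldots,v_{n-1}$ with edge set $\{v_0v_1,\ldots,v_0v_{n-3},\,v_{n-3}v_{n-2},\,v_{n-2}v_{n-1}\}$. For a graph $L$, $ex(p;L)$ denotes the maximal number of edges in a graph on $p$ vertices that does not contain $L$ as a (not necessarily induced) subgraph. *)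

theory Defs
  imports Complex_Main "HOL-Library.Ramsey"
begin

text \<open>A finite simple graph is a pair of a finite vertex set and a set of two-element subsets
  of it; \<open>nsets V 2\<close> is the set of all two-element subsets of \<open>V\<close>.\<close>

type_synonym 'a graph = "'a set \<times> 'a set set"

abbreviation verts :: "'a graph \<Rightarrow> 'a set" where "verts G \<equiv> fst G"
abbreviation edges :: "'a graph \<Rightarrow> 'a set set" where "edges G \<equiv> snd G"

definition simple_graph :: "'a graph \<Rightarrow> bool" where
  "simple_graph G \<longleftrightarrow> finite (verts G) \<and> edges G \<subseteq> nsets (verts G) 2"

text \<open>\<open>contains_subgraph G L\<close>: some (not necessarily induced) subgraph of \<open>G\<close> is isomorphic
  to \<open>L\<close>.\<close>

definition contains_subgraph :: "'a graph \<Rightarrow> 'b graph \<Rightarrow> bool" where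
  "contains_subgraph G L \<longleftrightarrow>
     (\<exists>f. inj_on f (verts L) \<and> f ` verts L \<subseteq> verts G \<and> (\<forall>e \<in> edges L. f ` e \<in> edges G))"

text \<open>The vertices of the host graphs are taken to be natural numbers. This loses no
  generality, since every finite graph is isomorphic to one on a set of natural numbers.
  The maximum is meaningful whenever \<open>L\<close> has an edge: see \<open>ex_set_finite\<close> and
  \<open>ex_set_nonempty\<close>.\<close>

definition ex_set :: "nat \<Rightarrow> 'b graph \<Rightarrow> nat set" where
  "ex_set p L = {card (edges G) | G :: nat graph.
     simple_graph G \<and> card (verts G) = p \<and> \<not> contains_subgraph G L}"

definition ex :: "nat \<Rightarrow> 'b graph \<Rightarrow> nat" where
  "ex p L = Max (ex_set p L)"

text \<open>Vertex \<open>v\<^sub>i\<close> is represented by \<open>i\<close>. The natural-number subtractions are proper for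
  \<open>n \<ge> 4\<close>, the range in which the tree is defined.\<close>

definition T_star :: "nat \<Rightarrow> nat graph" where
  "T_star n = ({0..<n}, {{0, i} | i. i \<in> {1..n - 3}} \<union> {{n - 3, n - 2}, {n - 2, n - 1}})"

lemma simple_graph_T_star: "n \<ge> 4 \<Longrightarrow> simple_graph (T_star n)"
  by (auto simp: simple_graph_def T_star_def nsets_def)

lemma ex_set_finite: "finite (ex_set p L)"
proof (rule finite_subset)
  show "ex_set p L \<subseteq> {..2 ^ p}"
  proof
    fix m assume "m \<in> ex_set p L"
    then obtain G :: "nat graph" where G: "m = card (edges G)" "simple_graph G" "card (verts G) = p"
      by (auto simp: ex_set_def)
    have "finite (verts G)" "edges G \<subseteq> Pow (verts G)"
      using G(2) by (auto simp: simple_graph_def nsets_def)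
    then have "card (edges G) \<le> card (Pow (verts G))"
      by (intro card_mono) auto
    then show "m \<in> {..2 ^ p}" using G \<open>finite (verts G)\<close> by (simp add: card_Pow)
  qed
qed simp

lemma ex_set_nonempty: "edges L \<noteq> {} \<Longrightarrow> ex_set p L \<noteq> {}"
proof -
  assume "edges L \<noteq> {}"
  then have "simple_graph ({0..<p}, {}) \<and> card (verts ({0..<p}, {} :: nat set set)) = p
      \<and> \<not> contains_subgraph ({0..<p}, {} :: nat set set) L"
    by (auto simp: simple_graph_def contains_subgraph_def)
  then show ?thesis unfolding ex_set_def by blast
qed

end

theory Submission
  imports Defs
begin

text \<open>Put \<open>d = n - 1\<close> and call \<open>(d - 1) p - 2 e\<close> the defect of a graph with \<open>p\<close> vertices and
  \<open>e\<close> edges, so that disjoint copies of \<open>K\<^sub>d\<close> have defect \<open>0\<close>. The claim is that the least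
  defect of a graph without \<open>T\<^sub>n\<^sup>*\<close> is unchanged when \<open>d\<close> is subtracted from \<open>p \<ge> 2d\<close>, and that
  for \<open>p = d + r\<close> with \<open>r \<in> {0, d - 3, d - 2, d - 1}\<close> it is \<open>r (d - r)\<close>, the defect of
  \<open>K\<^sub>d \<union> K\<^sub>r\<close>. A component on \<open>m > d\<close> vertices has defect at least \<open>m\<close>, because a vertex of
  degree at least \<open>d - 2\<close> makes its surroundings sparse. Two components with fewer than \<open>d\<close>
  vertices can be merged or exchanged for \<open>K\<^sub>d\<close> and a smaller complete graph; larger components
  are exchanged for \<open>K\<^sub>d\<close> and either a nearly \<open>(d - 3)\<close>-regular graph or the join of an
  independent set with a nearly regular graph on \<open>d - 2\<close> vertices.\<close>

section \<open>Graphs as symmetric relations\<close>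

definition nbrs :: "'a set \<Rightarrow> ('a \<Rightarrow> 'a \<Rightarrow> bool) \<Rightarrow> 'a \<Rightarrow> 'a set" where
  "nbrs V E v = {w \<in> V. E v w}"

lemma in_nbrs [simp]: "w \<in> nbrs V E v \<longleftrightarrow> w \<in> V \<and> E v w"
  by (simp add: nbrs_def)

lemma finite_nbrs [simp]: "finite V \<Longrightarrow> finite (nbrs V E v)"
  by (simp add: nbrs_def)

lemma nbrs_subset: "nbrs V E v \<subseteq> V"
  by auto

text \<open>\<open>v\<close> is the image of the centre \<open>v\<^sub>0\<close> and \<open>v, a, b, c\<close> that of the long leg
  \<open>v\<^sub>0, v\<^sub>n\<^sub>-\<^sub>3, v\<^sub>n\<^sub>-\<^sub>2, v\<^sub>n\<^sub>-\<^sub>1\<close>; the \<open>n - 4 = d - 3\<close> leaves need further neighbours of \<open>v\<close>.\<close>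

definition spider_free :: "nat \<Rightarrow> 'a set \<Rightarrow> ('a \<Rightarrow> 'a \<Rightarrow> bool) \<Rightarrow> bool" where
  "spider_free d V E \<longleftrightarrow> (\<forall>v\<in>V. \<forall>a\<in>V. \<forall>b\<in>V. \<forall>c\<in>V.
     E v a \<longrightarrow> E a b \<longrightarrow> E b c \<longrightarrow> b \<noteq> v \<longrightarrow> c \<noteq> v \<longrightarrow> c \<noteq> a \<longrightarrow>
     card (nbrs V E v - {a, b, c}) + 3 < d)"

lemma spider_freeD:
  assumes "spider_free d V E" "v \<in> V" "a \<in> V" "b \<in> V" "c \<in> V" "E v a" "E a b" "E b c"
    "b \<noteq> v" "c \<noteq> v" "c \<noteq> a"
  shows "card (nbrs V E v - {a, b, c}) + 3 < d"
  using assms unfolding spider_free_def by blast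

lemma spider_free_mono:
  assumes "spider_free d V E" "U \<subseteq> V" "finite V"
  shows "spider_free d U E"
  unfolding spider_free_def
proof (intro ballI impI)
  fix v a b c
  assume *: "v \<in> U" "a \<in> U" "b \<in> U" "c \<in> U" "E v a" "E a b" "E b c" "b \<noteq> v" "c \<noteq> v" "c \<noteq> a"
  have "card (nbrs U E v - {a, b, c}) \<le> card (nbrs V E v - {a, b, c})"
    using assms by (intro card_mono) auto
  moreover have "card (nbrs V E v - {a, b, c}) + 3 < d"
    using * assms(2) by (intro spider_freeD[OF assms(1)]) auto
  ultimately show "card (nbrs U E v - {a, b, c}) + 3 < d" by linarith
qed

text \<open>An embedding sends \<open>0\<close>, \<open>d - 2\<close>, \<open>d - 1\<close>,
  \<open>d\<close> to \<open>v\<close>, \<open>a\<close>, \<open>b\<close>, \<open>c\<close> and the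
  leaves \<open>1\<close>, ..., \<open>d - 3\<close> to neighbours of \<open>v\<close> outside
  \<open>{a, b, c}\<close>. Conversely any \<open>d - 3\<close> such neighbours can serve as the
  leaves.\<close>

lemma contains_T_star_iff:
  assumes "simple_graph G" and d: "d \<ge> 5"
  shows "contains_subgraph G (T_star (d + 1)) \<longleftrightarrow>
    \<not> spider_free d (verts G) (\<lambda>u w. {u, w} \<in> edges G)"
    (is "_ \<longleftrightarrow> \<not> spider_free d ?V ?E")
proof
  have fin: "finite ?V" using assms by (simp add: simple_graph_def)
  assume "contains_subgraph G (T_star (d + 1))"
  moreover have "verts (T_star (d + 1)) = {0..<d+1}" by (simp add: T_star_def)
  ultimately obtain f where inj: "inj_on f {0..<d+1}" and fV: "f ` {0..<d+1} \<subseteq> ?V"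
    and fE: "\<And>e. e \<in> edges (T_star (d + 1)) \<Longrightarrow> f ` e \<in> edges G"
    unfolding contains_subgraph_def by (elim exE conjE) simp
  have fV': "f i \<in> ?V" if "i \<le> d" for i
    using fV that by auto
  have ne: "f i \<noteq> f j" if "i \<le> d" "j \<le> d" "i \<noteq> j" for i j
    using inj_onD[OF inj, of i j] that by auto
  have spoke: "{f 0, f i} \<in> edges G" if "1 \<le> i" "i \<le> d - 2" for i
  proof -
    have "{0, i} \<in> edges (T_star (d + 1))"
      using that d by (auto simp: T_star_def)
    from fE[OF this] show ?thesis by simp
  qed
  have ab: "{f (d - 2), f (d - 1)} \<in> edges G"
    using fE[of "{d - 2, d - 1}"] d by (simp add: T_star_def)
  have bc: "{f (d - 1), f d} \<in> edges G"
    using fE[of "{d - 1, d}"] d by (simp add: T_star_def)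
  have "d - 3 = card (f ` {1..d - 3})"
    using card_image[OF inj_on_subset[OF inj, of "{1..d-3}"]] by fastforce
  also have "\<dots> \<le> card (nbrs ?V ?E (f 0) - {f (d - 2), f (d - 1), f d})"
  proof (rule card_mono)
    show "f ` {1..d - 3} \<subseteq> nbrs ?V ?E (f 0) - {f (d - 2), f (d - 1), f d}"
    proof
      fix x assume "x \<in> f ` {1..d - 3}"
      then obtain i where i: "x = f i" "1 \<le> i" "i \<le> d - 3" by auto
      then have "i \<le> d" "i \<noteq> d - 2" "i \<noteq> d - 1" "i \<noteq> d" using d by auto
      then have "f i \<noteq> f (d - 2)" "f i \<noteq> f (d - 1)" "f i \<noteq> f d"
        using ne[of i "d - 2"] ne[of i "d - 1"] ne[of i d] by auto
      then show "x \<in> nbrs ?V ?E (f 0) - {f (d - 2), f (d - 1), f d}"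
        using i spoke[of i] fV'[of i] d by simp
    qed
  qed (use fin in simp)
  finally have "\<not> card (nbrs ?V ?E (f 0) - {f (d - 2), f (d - 1), f d}) + 3 < d"
    using d by linarith
  moreover have "f (d - 1) \<noteq> f 0" "f d \<noteq> f 0" "f d \<noteq> f (d - 2)"
    using d ne[of "d - 1" 0] ne[of d 0] ne[of d "d - 2"] by auto
  ultimately show "\<not> spider_free d ?V ?E"
    using spider_freeD[of d ?V ?E "f 0" "f (d - 2)" "f (d - 1)" "f d"] fV' spoke[of "d - 2"] ab bc d
    by auto
next
  have fin: "finite ?V" and e2: "\<And>e. e \<in> edges G \<Longrightarrow> card e = 2"
    using assms by (auto simp: simple_graph_def nsets_def)
  have irr: "{x} \<notin> edges G" for x using e2[of "{x}"] by auto
  assume "\<not> spider_free d ?V ?E"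
  then obtain v a b c where
    V: "v \<in> ?V" "a \<in> ?V" "b \<in> ?V" "c \<in> ?V"
    and E: "{v, a} \<in> edges G" "{a, b} \<in> edges G" "{b, c} \<in> edges G"
    and ne: "b \<noteq> v" "c \<noteq> v" "c \<noteq> a"
    and big: "d - 3 \<le> card (nbrs ?V ?E v - {a, b, c})"
    unfolding spider_free_def by fastforce
  have ne': "v \<noteq> a" "a \<noteq> b" "b \<noteq> c" using E irr by auto
  obtain L where L: "L \<subseteq> nbrs ?V ?E v - {a, b, c}" "card L = d - 3" "finite L"
    using obtain_subset_with_card_n[OF big] by auto
  obtain g where g: "bij_betw g {1..d - 3} L"
    using finite_same_card_bij[of "{1..d - 3}" L] L by auto
  have gL: "g i \<in> L" if "1 \<le> i" "i \<le> d - 3" for i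
    using bij_betwE[OF g] that by auto
  have gL': "g i \<in> ?V" "{v, g i} \<in> edges G" "g i \<noteq> a" "g i \<noteq> b" "g i \<noteq> c" "g i \<noteq> v"
    if "1 \<le> i" "i \<le> d - 3" for i
    using gL[OF that] L(1) irr[of v] by auto
  have ginj: "i = j" if "1 \<le> i" "i \<le> d - 3" "1 \<le> j" "j \<le> d - 3" "g i = g j" for i j
    using inj_onD[OF bij_betw_imp_inj_on[OF g], of i j] that by auto
  define f where "f i = (if i = 0 then v else if i \<le> d - 3 then g i
     else if i = d - 2 then a else if i = d - 1 then b else c)" for i
  have f0: "f 0 = v" and fa: "f (d - 2) = a" and fb: "f (d - 1) = b" and fc: "f d = c"
    using d by (auto simp: f_def)
  have fg: "f i = g i" if "1 \<le> i" "i \<le> d - 3" for i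
    using that by (auto simp: f_def)
  have cases: "i = 0 \<or> (1 \<le> i \<and> i \<le> d - 3) \<or> i = d - 2 \<or> i = d - 1 \<or> i = d" if "i < d + 1" for i
    using that by linarith
  have "inj_on f {0..<d + 1}"
  proof (rule inj_onI)
    fix i j assume "i \<in> {0..<d + 1}" "j \<in> {0..<d + 1}" "f i = f j"
    then have "i < d + 1" "j < d + 1" "f i = f j" by auto
    from cases[OF this(1)] cases[OF this(2)] this(3) show "i = j"
      by (elim disjE conjE; simp add: f0 fa fb fc fg gL' gL'(3-6)[symmetric] ne ne[symmetric]
          ne' ne'[symmetric] ginj del: One_nat_def)
  qed
  moreover have "f ` {0..<d + 1} \<subseteq> ?V"
  proof
    fix x assume "x \<in> f ` {0..<d + 1}"
    then obtain i where "x = f i" "i < d + 1" by auto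
    from cases[OF this(2)] this(1) show "x \<in> ?V"
      by (elim disjE conjE; simp add: f0 fa fb fc fg gL' V del: One_nat_def)
  qed
  moreover have "f ` e \<in> edges G" if "e \<in> edges (T_star (d + 1))" for e
  proof -
    from that consider i where "e = {0, i}" "1 \<le> i" "i \<le> d - 2" | "e = {d - 2, d - 1}" | "e = {d - 1, d}"
      using d by (auto simp: T_star_def)
    then show ?thesis
    proof cases
      case 1
      show ?thesis
      proof (cases "i = d - 2")
        case True
        then show ?thesis using 1 f0 fa E by simp
      next
        case False
        then have "1 \<le> i" "i \<le> d - 3" using 1 by auto
        then show ?thesis using 1 f0 fg gL' by simp
      qed
    qed (use fa fb fc E in auto)
  qed
  ultimately show "contains_subgraph G (T_star (d + 1))"
    unfolding contains_subgraph_def by (intro exI[of _ f]) (simp add: T_star_def)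
qed

text \<open>The handshake lemma: every edge is counted once at each of its two ends.\<close>

lemma sum_card_nbrs:
  assumes "simple_graph G"
  shows "(\<Sum>v\<in>verts G. card (nbrs (verts G) (\<lambda>u w. {u, w} \<in> edges G) v)) = 2 * card (edges G)"
proof -
  let ?V = "verts G" and ?E = "\<lambda>u w. {u, w} \<in> edges G"
  have fin: "finite ?V" and sub: "\<And>e. e \<in> edges G \<Longrightarrow> e \<subseteq> ?V \<and> card e = 2"
    using assms by (auto simp: simple_graph_def nsets_def)
  have "edges G \<subseteq> Pow ?V" using sub by auto
  then have finE: "finite (edges G)" using fin by (meson finite_Pow_iff finite_subset)
  have "card (nbrs ?V ?E v) = card {e \<in> edges G. v \<in> e}" if "v \<in> ?V" for v
  proof (rule bij_betw_same_card)
    show "bij_betw (\<lambda>w. {v, w}) (nbrs ?V ?E v) {e \<in> edges G. v \<in> e}"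
      unfolding bij_betw_def
    proof
      show "inj_on (\<lambda>w. {v, w}) (nbrs ?V ?E v)"
        by (auto simp: inj_on_def doubleton_eq_iff)
      show "(\<lambda>w. {v, w}) ` nbrs ?V ?E v = {e \<in> edges G. v \<in> e}"
      proof (intro equalityI subsetI)
        fix e assume "e \<in> {e \<in> edges G. v \<in> e}"
        then have e: "e \<in> edges G" "v \<in> e" by auto
        then obtain x y where "e = {x, y}" using sub by (meson card_2_iff)
        then obtain w where "e = {v, w}" using e by auto
        then show "e \<in> (\<lambda>w. {v, w}) ` nbrs ?V ?E v"
          using e sub[of e] by auto
      qed auto
    qed
  qed
  then have "(\<Sum>v\<in>?V. card (nbrs ?V ?E v)) = (\<Sum>v\<in>?V. card {e \<in> edges G. v \<in> e})"
    by simp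
  also have "\<dots> = 2 * card (edges G)"
  proof (rule sum_multicount[OF fin finE], intro ballI)
    fix e assume "e \<in> edges G"
    then have "{v \<in> ?V. v \<in> e} = e" "card e = 2" using sub by auto
    then show "card {v \<in> ?V. v \<in> e} = 2" by simp
  qed
  finally show ?thesis .
qed

text \<open>\<open>ex\<close> ranges over graphs on natural numbers, whereas some constructions
  below live on sum types; the graph is therefore transported along a bijection with
  \<open>{0..<m}\<close>.\<close>

lemma sum_nbrs_le_ex:
  assumes "symp E" "irreflp E" "finite V" "spider_free d V E" and d: "d \<ge> 5"
  shows "(\<Sum>v\<in>V. card (nbrs V E v)) \<le> 2 * ex (card V) (T_star (d + 1))"
proof -
  define m where "m = card V"
  obtain f where f: "bij_betw f {0..<m} V"
    using ex_bij_betw_nat_finite[OF assms(3)] m_def by auto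
  define F where "F i j \<longleftrightarrow> E (f i) (f j)" for i j
  define G where "G = ({0..<m}, {{i, j} | i j. i < m \<and> j < m \<and> F i j})"
  have finj: "inj_on f {0..<m}" and fV: "f ` {0..<m} = V" using f by (auto simp: bij_betw_def)
  have sg: "simple_graph G"
    using assms(2) by (auto simp: simple_graph_def G_def nsets_def F_def irreflp_def card_insert_if)
  have edge: "{i, j} \<in> edges G \<longleftrightarrow> i < m \<and> j < m \<and> F i j" for i j
    using assms(1) by (auto simp: G_def doubleton_eq_iff F_def symp_def)
  have vG: "verts G = {0..<m}" by (simp add: G_def)
  have nbG: "nbrs (verts G) (\<lambda>u w. {u, w} \<in> edges G) i = nbrs {0..<m} F i" if "i < m" for i
    unfolding nbrs_def vG edge using that by auto
  have img: "f ` nbrs {0..<m} F i = nbrs V E (f i)" for i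
    using fV by (auto simp: F_def)
  have cardeq: "card (nbrs {0..<m} F i) = card (nbrs V E (f i))" for i
    using card_image[OF inj_on_subset[OF finj nbrs_subset], of F i] by (simp add: img)
  have "spider_free d (verts G) (\<lambda>u w. {u, w} \<in> edges G)"
    unfolding spider_free_def
  proof (intro ballI impI)
    fix v a b c
    assume V: "v \<in> verts G" "a \<in> verts G" "b \<in> verts G" "c \<in> verts G"
      and E: "{v, a} \<in> edges G" "{a, b} \<in> edges G" "{b, c} \<in> edges G"
      and ne: "b \<noteq> v" "c \<noteq> v" "c \<noteq> a"
    have lt: "v < m" "a < m" "b < m" "c < m" using V by (auto simp: G_def)
    have fne: "f b \<noteq> f v" "f c \<noteq> f v" "f c \<noteq> f a"
      using ne lt inj_onD[OF finj, of b v] inj_onD[OF finj, of c v] inj_onD[OF finj, of c a] by auto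
    have "f ` (nbrs {0..<m} F v - {a, b, c}) = f ` nbrs {0..<m} F v - f ` {a, b, c}"
      using lt by (intro inj_on_image_set_diff[OF finj]) (auto simp: nbrs_def)
    then have "f ` (nbrs {0..<m} F v - {a, b, c}) = nbrs V E (f v) - {f a, f b, f c}"
      by (simp add: img)
    then have "card (nbrs {0..<m} F v - {a, b, c}) = card (nbrs V E (f v) - {f a, f b, f c})"
      using card_image[OF inj_on_subset[OF finj, of "nbrs {0..<m} F v - {a, b, c}"]]
      by (simp add: nbrs_def Collect_mono Diff_subset subset_iff)
    also have "\<dots> + 3 < d"
      using lt E fne fV by (intro spider_freeD[OF assms(4)]) (auto simp: edge F_def)
    finally show "card (nbrs (verts G) (\<lambda>u w. {u, w} \<in> edges G) v - {a, b, c}) + 3 < d"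
      using nbG lt by simp
  qed
  then have "\<not> contains_subgraph G (T_star (d + 1))"
    using contains_T_star_iff[OF sg d] by blast
  moreover have "card (verts G) = m" by (simp add: vG)
  ultimately have "card (edges G) \<in> ex_set m (T_star (d + 1))"
    unfolding ex_set_def using sg by blast
  then have "card (edges G) \<le> ex m (T_star (d + 1))"
    unfolding ex_def using ex_set_finite by (intro Max_ge)
  moreover have "(\<Sum>v\<in>V. card (nbrs V E v)) = 2 * card (edges G)"
  proof -
    have "(\<Sum>v\<in>V. card (nbrs V E v)) = (\<Sum>i\<in>{0..<m}. card (nbrs V E (f i)))"
      using sum.reindex[OF finj, of "\<lambda>v. card (nbrs V E v)"] fV by simp
    also have "\<dots> = (\<Sum>v\<in>verts G. card (nbrs (verts G) (\<lambda>u w. {u, w} \<in> edges G) v))"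
      using nbG cardeq by (intro sum.cong) (auto simp: G_def)
    finally show ?thesis using sum_card_nbrs[OF sg] by simp
  qed
  ultimately show ?thesis by (simp add: m_def)
qed

lemma ex_attained:
  assumes d: "d \<ge> 5"
  obtains V :: "nat set" and E where "finite V" "card V = m" "symp E" "irreflp E" "spider_free d V E"
    "(\<Sum>v\<in>V. card (nbrs V E v)) = 2 * ex m (T_star (d + 1))"
proof -
  have "ex m (T_star (d + 1)) \<in> ex_set m (T_star (d + 1))"
    unfolding ex_def by (intro Max_in ex_set_finite ex_set_nonempty) (auto simp: T_star_def)
  then obtain G :: "nat graph" where G: "ex m (T_star (d + 1)) = card (edges G)" "simple_graph G"
      "card (verts G) = m" "\<not> contains_subgraph G (T_star (d + 1))"
    by (auto simp: ex_set_def)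
  let ?E = "\<lambda>u w. {u, w} \<in> edges G"
  show ?thesis
  proof (rule that[of "verts G" ?E])
    show "symp ?E" by (auto simp: symp_def insert_commute)
    show "irreflp ?E" using G(2) by (force simp: irreflp_def simple_graph_def nsets_def)
  qed (use G sum_card_nbrs[OF G(2)] contains_T_star_iff[OF G(2) d] in
        \<open>auto simp: simple_graph_def\<close>)
qed

section \<open>Graphs of small defect\<close>

text \<open>A sum of vertex deficiencies \<open>d - 1 - deg v\<close>, which makes additivity over
  components immediate. The values are integers because vertices of degree at least \<open>d\<close>
  contribute negatively.\<close>

definition defect :: "nat \<Rightarrow> 'a set \<Rightarrow> ('a \<Rightarrow> 'a \<Rightarrow> bool) \<Rightarrow> int" where
  "defect d V E = (\<Sum>v\<in>V. int d - 1 - int (card (nbrs V E v)))"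

definition min_defect :: "nat \<Rightarrow> nat \<Rightarrow> int" where
  "min_defect d m = (int d - 1) * int m - 2 * int (ex m (T_star (d + 1)))"

lemma defect_eq: "defect d V E = (int d - 1) * int (card V) - int (\<Sum>v\<in>V. card (nbrs V E v))"
  by (simp add: defect_def sum_subtractf sum.distrib algebra_simps)

lemma min_defect_le:
  assumes "symp E" "irreflp E" "finite V" "spider_free d V E" "d \<ge> 5"
  shows "min_defect d (card V) \<le> defect d V E"
  using sum_nbrs_le_ex[OF assms] unfolding min_defect_def defect_eq by linarith

lemma min_defect_attained:
  assumes "d \<ge> 5"
  obtains V :: "nat set" and E where "finite V" "card V = m" "symp E" "irreflp E" "spider_free d V E"
    "defect d V E = min_defect d m"
proof -
  obtain V :: "nat set" and E where *: "finite V" "card V = m" "symp E" "irreflp E"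
      "spider_free d V E" "(\<Sum>v\<in>V. card (nbrs V E v)) = 2 * ex m (T_star (d + 1))"
    using ex_attained[OF assms] by blast
  then have "defect d V E = min_defect d m"
    by (simp only: min_defect_def defect_eq of_nat_mult of_nat_numeral)
  with * show ?thesis using that by blast
qed

section \<open>Disjoint unions, joins and complete graphs\<close>

fun sum_rel :: "('a \<Rightarrow> 'a \<Rightarrow> bool) \<Rightarrow> ('b \<Rightarrow> 'b \<Rightarrow> bool) \<Rightarrow> bool \<Rightarrow> 'a + 'b \<Rightarrow> 'a + 'b \<Rightarrow> bool" where
  "sum_rel E F c (Inl x) (Inl y) = E x y"
| "sum_rel E F c (Inr x) (Inr y) = F x y"
| "sum_rel E F c (Inl x) (Inr y) = c"
| "sum_rel E F c (Inr x) (Inl y) = c"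

lemma symp_sum_rel: "symp E \<Longrightarrow> symp F \<Longrightarrow> symp (sum_rel E F c)"
  unfolding symp_def
  apply (intro allI impI)
  subgoal for x y by (cases x; cases y) auto
  done

lemma irreflp_sum_rel: "irreflp E \<Longrightarrow> irreflp F \<Longrightarrow> irreflp (sum_rel E F c)"
  unfolding irreflp_def
  apply (intro allI)
  subgoal for x by (cases x) auto
  done

lemma nbrs_sum_rel:
  "nbrs (V <+> W) (sum_rel E F c) (Inl x) = nbrs V E x <+> (if c then W else {})"
  "nbrs (V <+> W) (sum_rel E F c) (Inr y) = (if c then V else {}) <+> nbrs W F y"
  by (auto simp: nbrs_def)

lemma sum_Plus':
  "finite V \<Longrightarrow> finite W \<Longrightarrow> (\<Sum>x\<in>V <+> W. f x) = (\<Sum>x\<in>V. f (Inl x)) + (\<Sum>y\<in>W. f (Inr y))"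
  by (simp add: sum.Plus comp_def)

text \<open>Take the disjoint union of two extremal graphs, the flag \<open>False\<close> of
  \<open>sum_rel\<close> meaning no cross edges. The forbidden tree is connected, so it would lie
  inside one of the two parts, and defects add up.\<close>

lemma min_defect_add:
  assumes d: "d \<ge> 5"
  shows "min_defect d (a + b) \<le> min_defect d a + min_defect d b"
proof -
  obtain V :: "nat set" and E where V: "finite V" "card V = a" "symp E" "irreflp E"
      "spider_free d V E" "defect d V E = min_defect d a"
    using min_defect_attained[OF d] by blast
  obtain W :: "nat set" and F where W: "finite W" "card W = b" "symp F" "irreflp F"
      "spider_free d W F" "defect d W F = min_defect d b"
    using min_defect_attained[OF d] by blast
  let ?E = "sum_rel E F False"
  have "spider_free d (V <+> W) ?E"
    unfolding spider_free_def
  proof (intro ballI impI)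
    fix v a b c
    assume *: "v \<in> V <+> W" "a \<in> V <+> W" "b \<in> V <+> W" "c \<in> V <+> W"
      "?E v a" "?E a b" "?E b c" "b \<noteq> v" "c \<noteq> v" "c \<noteq> a"
    show "card (nbrs (V <+> W) ?E v - {a, b, c}) + 3 < d"
    proof (cases v)
      case (Inl v')
      obtain a' b' c' where abc: "a = Inl a'" "b = Inl b'" "c = Inl c'"
        using * Inl by (cases a; cases b; cases c) auto
      have "nbrs (V <+> W) ?E v - {a, b, c} = Inl ` (nbrs V E v' - {a', b', c'})"
        by (auto simp: Inl abc nbrs_sum_rel)
      then have "card (nbrs (V <+> W) ?E v - {a, b, c}) = card (nbrs V E v' - {a', b', c'})"
        by (simp add: card_image)
      moreover have "card (nbrs V E v' - {a', b', c'}) + 3 < d"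
        using * by (intro spider_freeD[OF V(5)]) (auto simp: Inl abc)
      ultimately show ?thesis by simp
    next
      case (Inr v')
      obtain a' b' c' where abc: "a = Inr a'" "b = Inr b'" "c = Inr c'"
        using * Inr by (cases a; cases b; cases c) auto
      have "nbrs (V <+> W) ?E v - {a, b, c} = Inr ` (nbrs W F v' - {a', b', c'})"
        by (auto simp: Inr abc nbrs_sum_rel)
      then have "card (nbrs (V <+> W) ?E v - {a, b, c}) = card (nbrs W F v' - {a', b', c'})"
        by (simp add: card_image)
      moreover have "card (nbrs W F v' - {a', b', c'}) + 3 < d"
        using * by (intro spider_freeD[OF W(5)]) (auto simp: Inr abc)
      ultimately show ?thesis by simp
    qed
  qed
  then have "min_defect d (card (V <+> W)) \<le> defect d (V <+> W) ?E"
    using V W d by (intro min_defect_le symp_sum_rel irreflp_sum_rel) auto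
  moreover have "card (V <+> W) = a + b" using V W by (simp add: card_Plus)
  moreover have "defect d (V <+> W) ?E = defect d V E + defect d W F"
    unfolding defect_def using V W by (simp add: sum_Plus' nbrs_sum_rel card_Plus)
  ultimately show ?thesis using V W by simp
qed

text \<open>The complete graph on \<open>s\<close> \<le> \<open>d\<close> vertices is too small for
  a tree on \<open>d + 1\<close> vertices, and each of its vertices has deficiency
  \<open>d - s\<close>.\<close>

lemma min_defect_small:
  assumes d: "d \<ge> 5" and s: "s \<le> d"
  shows "min_defect d s \<le> int s * int (d - s)"
proof -
  let ?V = "{0..<s}" and ?E = "\<lambda>x y :: nat. x \<noteq> y"
  have nb: "nbrs ?V ?E v = ?V - {v}" for v by auto
  have "spider_free d ?V ?E"
    unfolding spider_free_def
  proof (intro ballI impI)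
    fix v a b c assume *: "v \<in> ?V" "a \<in> ?V" "b \<in> ?V" "c \<in> ?V"
      "v \<noteq> a" "a \<noteq> b" "b \<noteq> c" "b \<noteq> v" "c \<noteq> v" "c \<noteq> a"
    have "nbrs ?V ?E v - {a, b, c} = ?V - {v, a, b, c}" by auto
    moreover have "card (?V - {v, a, b, c}) = s - 4"
      using * by (subst card_Diff_subset) (auto simp: card_insert_if)
    ultimately have "card (nbrs ?V ?E v - {a, b, c}) = s - 4" by simp
    then show "card (nbrs ?V ?E v - {a, b, c}) + 3 < d" using s d by linarith
  qed
  then have "min_defect d (card ?V) \<le> defect d ?V ?E"
    using d by (intro min_defect_le) (auto simp: symp_def irreflp_def)
  also have "defect d ?V ?E = (\<Sum>v\<in>?V. int (d - s))"
    unfolding defect_def using s by (intro sum.cong) (auto simp: nb)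
  finally show ?thesis by simp
qed

text \<open>The centre of a forbidden tree needs \<open>d - 2\<close> neighbours: \<open>a\<close>
  and \<open>d - 3\<close> leaves. If it has exactly that many, then \<open>b\<close> and
  \<open>c\<close> are adjacent non-neighbours of it, which the second alternative excludes.\<close>

lemma spider_free_low_degree:
  assumes "finite V" "irreflp E" "symp E" "d \<ge> 5"
    and low: "\<And>v. v \<in> V \<Longrightarrow> card (nbrs V E v) + 3 \<le> d \<or> (card (nbrs V E v) + 2 \<le> d \<and>
      (\<forall>x\<in>V. \<forall>y\<in>V. \<not> E v x \<longrightarrow> \<not> E v y \<longrightarrow> \<not> E x y))"
  shows "spider_free d V E"
  unfolding spider_free_def
proof (intro ballI impI)
  fix v a b c
  assume *: "v \<in> V" "a \<in> V" "b \<in> V" "c \<in> V" "E v a" "E a b" "E b c" "b \<noteq> v" "c \<noteq> v" "c \<noteq> a"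
  have fin: "finite (nbrs V E v)" using assms(1) by simp
  have bc: "b \<noteq> c" "a \<noteq> b" using irreflpD[OF assms(2)] *(6,7) by blast+
  from low[OF *(1)] show "card (nbrs V E v - {a, b, c}) + 3 < d"
  proof
    assume le: "card (nbrs V E v) + 3 \<le> d"
    have "nbrs V E v - {a, b, c} \<subset> nbrs V E v"
      using *(2,5) by (intro psubsetI) (auto simp: set_eq_iff)
    then have "card (nbrs V E v - {a, b, c}) < card (nbrs V E v)"
      by (rule psubset_card_mono[OF fin])
    then show ?thesis using le by linarith
  next
    assume le: "card (nbrs V E v) + 2 \<le> d \<and>
      (\<forall>x\<in>V. \<forall>y\<in>V. \<not> E v x \<longrightarrow> \<not> E v y \<longrightarrow> \<not> E x y)"
    then have "E v b \<or> E v c" using *(3,4,7) by blast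
    then obtain x where x: "x \<in> {b, c}" "E v x" by blast
    have ax: "a \<noteq> x" using x(1) bc * by blast
    have "card (nbrs V E v - {a, b, c}) \<le> card (nbrs V E v - {a, x})"
      using x(1) fin by (intro card_mono) auto
    also have "\<dots> = card (nbrs V E v) - card {a, x}"
      using x *(2,3,4,5) by (intro card_Diff_subset) auto
    also have "card {a, x} = 2" using ax by simp
    finally have "card (nbrs V E v - {a, b, c}) \<le> card (nbrs V E v) - 2" .
    then show ?thesis using le assms(4) by linarith
  qed
qed

section \<open>Nearly regular graphs and joins with independent sets\<close>

lemma card_swap: "finite A \<Longrightarrow> y \<in> A \<Longrightarrow> u \<notin> A \<Longrightarrow> card (insert u (A - {y})) = card A"
  by (metis Diff_iff card_Suc_Diff1 card_insert_disjoint finite_Diff)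

text \<open>In a graph of maximum degree at most \<open>D\<close> with the largest number of edges, the total
  deficiency is at most one: otherwise two deficient vertices \<open>u\<close>, \<open>v\<close> could be joined or, if
  all deficient vertices are adjacent, some edge \<open>xy\<close> could be traded for \<open>ux\<close> and \<open>vy\<close>.\<close>

lemma near_regular_exists:
  fixes V :: "'a set"
  assumes fin: "finite V" and D: "D < card V"
  obtains E where "symp E" "irreflp E" "\<And>v. v \<in> V \<Longrightarrow> card (nbrs V E v) \<le> D"
    "D * card V \<le> (\<Sum>v\<in>V. card (nbrs V E v)) + 1"
proof -
  define ok where "ok E \<longleftrightarrow> symp E \<and> irreflp E \<and> (\<forall>v\<in>V. card (nbrs V E v) \<le> D)"
    for E :: "'a \<Rightarrow> 'a \<Rightarrow> bool"
  define size where "size E = (\<Sum>v\<in>V. card (nbrs V E v))" for E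
  have ok0: "ok (\<lambda>_ _. False)" by (simp add: ok_def symp_def irreflp_def nbrs_def)
  have bound: "\<forall>E. ok E \<longrightarrow> size E < D * card V + 1"
  proof (intro allI impI)
    fix E assume "ok E"
    then have "size E \<le> (\<Sum>v\<in>V. D)" unfolding size_def ok_def by (intro sum_mono) auto
    then show "size E < D * card V + 1" by (simp add: mult.commute)
  qed
  obtain E where okE: "ok E" and mx: "\<And>F. ok F \<Longrightarrow> size F \<le> size E"
    using ex_has_greatest_nat[OF ok0 bound] by blast
  have sym: "E x y \<Longrightarrow> E y x" and irr: "\<not> E x x" for x y
    using okE by (auto simp: ok_def symp_def irreflp_def)
  have deg: "card (nbrs V E v) \<le> D" if "v \<in> V" for v
    using okE that by (simp add: ok_def)
  have no_better: False
    if "symp F" "irreflp F" "\<And>v. v \<in> V \<Longrightarrow> card (nbrs V F v) \<le> D"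
      "\<And>v. v \<in> V \<Longrightarrow> card (nbrs V E v) \<le> card (nbrs V F v)"
      "u \<in> V" "card (nbrs V E u) < card (nbrs V F u)" for F u
  proof -
    have "size E < size F"
      unfolding size_def using that fin by (intro sum_strict_mono_ex1) auto
    moreover have "size F \<le> size E"
      using that by (intro mx) (simp add: ok_def)
    ultimately show False by simp
  qed
  have "D * card V \<le> size E + 1"
  proof (rule ccontr)
    assume "\<not> D * card V \<le> size E + 1"
    then have less: "size E + 2 \<le> D * card V" by simp
    have "\<exists>u\<in>V. card (nbrs V E u) < D"
    proof (rule ccontr)
      assume "\<not> ?thesis"
      then have "(\<Sum>v\<in>V. D) \<le> size E" unfolding size_def by (intro sum_mono) force
      then show False using less by (simp add: mult.commute)
    qed
    then obtain u where u: "u \<in> V" "card (nbrs V E u) < D" by auto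
    \<comment> \<open>Total deficiency at least two means two deficient vertices, or a single one
      that lacks two edges; the latter is recorded as \<open>v = u\<close>.\<close>
    have "\<exists>v\<in>V. card (nbrs V E v) < D \<and> (v = u \<longrightarrow> card (nbrs V E u) + 2 \<le> D)"
    proof (rule ccontr)
      assume *: "\<not> ?thesis"
      then have "\<not> card (nbrs V E u) + 2 \<le> D" using u by blast
      then have 1: "card (nbrs V E u) + 1 = D" using u by linarith
      have "D \<le> card (nbrs V E v)" if "v \<in> V - {u}" for v
        unfolding not_less[symmetric] using * that by blast
      then have "(\<Sum>v\<in>V - {u}. D) \<le> (\<Sum>v\<in>V - {u}. card (nbrs V E v))" by (intro sum_mono) auto
      moreover have "size E = card (nbrs V E u) + (\<Sum>v\<in>V - {u}. card (nbrs V E v))"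
        unfolding size_def using fin u by (intro sum.remove) auto
      moreover have "D * card V = D + (\<Sum>v\<in>V - {u}. D)"
        using sum.remove[OF fin u(1), of "\<lambda>_. D"] by (simp add: mult.commute)
      ultimately show False using less 1 by linarith
    qed
    then obtain v where v: "v \<in> V" "card (nbrs V E v) < D"
      and vu: "v = u \<Longrightarrow> card (nbrs V E u) + 2 \<le> D" by auto
    show False
    proof (cases "\<exists>a\<in>V. \<exists>b\<in>V. a \<noteq> b \<and> \<not> E a b \<and> card (nbrs V E a) < D \<and> card (nbrs V E b) < D")
      case True
      then obtain a b where ab: "a \<in> V" "b \<in> V" "a \<noteq> b" "\<not> E a b"
        "card (nbrs V E a) < D" "card (nbrs V E b) < D" by auto
      have ba: "\<not> E b a" using ab sym by blast
      define F where "F s t \<longleftrightarrow> E s t \<or> (s = a \<and> t = b) \<or> (s = b \<and> t = a)" for s t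
      have nF: "nbrs V F w = (if w = a then insert b (nbrs V E a)
          else if w = b then insert a (nbrs V E b) else nbrs V E w)" for w
        using ab by (auto simp: F_def)
      have cF: "card (nbrs V F w) =
          (if w = a \<or> w = b then card (nbrs V E w) + 1 else card (nbrs V E w))" for w
        using ab ba fin by (auto simp: nF)
      show False
        using ab deg
        by (intro no_better[of F a]) (auto simp: cF symp_def irreflp_def F_def irr intro: sym)
    next
      case False
      then have adj: "E a b" if "a \<in> V" "b \<in> V" "a \<noteq> b" "card (nbrs V E a) < D"
        "card (nbrs V E b) < D" for a b
        using that by blast
      \<comment> \<open>The degree of \<open>u\<close> is below \<open>D\<close>, and
        \<open>D\<close> \<le> \<open>card V - 1\<close>, so some \<open>x\<close> is missed by
        \<open>u\<close>. As deficient vertices are pairwise adjacent, \<open>x\<close> has full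
        degree \<open>D\<close>.\<close>
      have "\<not> V - {u} \<subseteq> nbrs V E u"
      proof
        assume "V - {u} \<subseteq> nbrs V E u"
        then have "card (V - {u}) \<le> card (nbrs V E u)" using fin by (intro card_mono) auto
        then show False using u D fin by simp
      qed
      then obtain x where x: "x \<in> V" "x \<noteq> u" "\<not> E u x" unfolding nbrs_def by blast
      have xu: "\<not> E x u" using x sym by blast
      have xv: "x \<noteq> v" using x adj[of u v] u v by auto
      have degx: "card (nbrs V E x) = D" using adj[of u x] deg[of x] x u by force
      \<comment> \<open>A neighbour \<open>y\<close> of \<open>x\<close> missed by \<open>v\<close>
        is wanted. If \<open>v\<close> saw all of them, its degree would reach \<open>D\<close>; for
        \<open>v \<noteq> u\<close> the neighbour \<open>u\<close> of \<open>v\<close>, not adjacent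
        to \<open>x\<close>, makes up for a possible edge between \<open>x\<close> and
        \<open>v\<close>.\<close>
      have "\<not> nbrs V E x - {v} \<subseteq> nbrs V E v"
      proof
        assume sub: "nbrs V E x - {v} \<subseteq> nbrs V E v"
        show False
        proof (cases "v = u")
          case True
          then have "nbrs V E x \<subseteq> nbrs V E u" using sub xu by auto
          then have "card (nbrs V E x) \<le> card (nbrs V E u)" using fin by (intro card_mono) auto
          then show False using degx u by simp
        next
          case neq: False
          have "E v u" using adj u v neq by blast
          have "card (nbrs V E x - {v}) \<le> card (nbrs V E v - {u})"
            using sub xu fin by (intro card_mono) auto
          moreover have "card (nbrs V E v - {u}) = card (nbrs V E v) - 1"
            using \<open>E v u\<close> u fin by simp
          moreover have "card (nbrs V E x - {v}) \<ge> card (nbrs V E x) - 1"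
            using fin diff_card_le_card_Diff[of "{v}"] by simp
          ultimately have "D - 1 \<le> card (nbrs V E v) - 1" using degx by linarith
          moreover have "card (nbrs V E v) > 0" using \<open>E v u\<close> u fin by (auto simp: card_gt_0_iff)
          ultimately show False using v by linarith
        qed
      qed
      then obtain y where y: "y \<in> V" "E x y" "y \<noteq> v" "\<not> E v y" unfolding nbrs_def by blast
      have yv: "\<not> E y v" and yx: "E y x" using y sym by blast+
      have yu: "y \<noteq> u" and xy: "x \<noteq> y" using y xu irr by auto
      \<comment> \<open>The edge \<open>xy\<close> is traded for \<open>ux\<close> and
        \<open>vy\<close>: the degrees of \<open>x\<close> and \<open>y\<close> stay, while
        \<open>u\<close> and \<open>v\<close> gain one each, or two in total when they
        coincide.\<close>
      define F where "F s t \<longleftrightarrow> (E s t \<and> {s, t} \<noteq> {x, y}) \<or> {s, t} = {u, x} \<or> {s, t} = {v, y}" for s t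
      have Fsym: "symp F" by (auto simp: symp_def F_def insert_commute intro: sym)
      have Firr: "irreflp F" using x y irr by (auto simp: irreflp_def F_def doubleton_eq_iff)
      have nx: "nbrs V F x = insert u (nbrs V E x - {y})"
        using x y u v xv xy yu by (auto simp: F_def doubleton_eq_iff)
      have ny: "nbrs V F y = insert v (nbrs V E y - {x})"
        using x y u v xv xy yu by (auto simp: F_def doubleton_eq_iff)
      have cx: "card (nbrs V F x) = card (nbrs V E x)"
        unfolding nx using fin y xu by (intro card_swap) auto
      have cy: "card (nbrs V F y) = card (nbrs V E y)"
        unfolding ny using fin x yx yv by (intro card_swap) auto
      have other: "nbrs V F w = nbrs V E w" if "w \<notin> {u, v, x, y}" for w
        using that by (auto simp: F_def doubleton_eq_iff)
      show False
      proof (cases "u = v")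
        case True
        have "nbrs V F u = insert x (insert y (nbrs V E u))"
          using x y u xv xy yu True by (auto simp: F_def doubleton_eq_iff)
        then have cu: "card (nbrs V F u) = card (nbrs V E u) + 2"
          using fin x y True xy by simp
        have "card (nbrs V F w) \<le> D \<and> card (nbrs V E w) \<le> card (nbrs V F w)" if "w \<in> V" for w
          using other[of w] cx cy cu deg[OF that] vu True by (cases "w \<in> {u, x, y}") auto
        then show False using u cu Fsym Firr by (intro no_better[of F u]) auto
      next
        case neq: False
        have "nbrs V F u = insert x (nbrs V E u)"
          using x y u xv xy yu neq by (auto simp: F_def doubleton_eq_iff)
        then have cu: "card (nbrs V F u) = card (nbrs V E u) + 1"
          using fin x by simp
        have "nbrs V F v = insert y (nbrs V E v)"
          using x y u xv xy yu neq by (auto simp: F_def doubleton_eq_iff)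
        then have cv: "card (nbrs V F v) = card (nbrs V E v) + 1"
          using fin y by simp
        have "card (nbrs V F w) \<le> D \<and> card (nbrs V E w) \<le> card (nbrs V F w)" if "w \<in> V" for w
          using other[of w] cx cy cu cv deg[OF that] u v by (cases "w \<in> {u, v, x, y}") auto
        then show False using u cu Fsym Firr by (intro no_better[of F u]) auto
      qed
    qed
  qed
  then show ?thesis
    using that[of E] okE by (auto simp: ok_def size_def)
qed

text \<open>Maximum degree \<open>d - 3\<close> leaves no possible centre. Each vertex has
  deficiency two, up to one missing degree in total.\<close>

lemma min_defect_near_regular:
  assumes d: "d \<ge> 5" and q: "d - 2 \<le> q"
  shows "min_defect d q \<le> 2 * int q + 1"
proof -
  have D: "d - 3 < card {0..<q}" using d q by simp
  obtain E :: "nat \<Rightarrow> nat \<Rightarrow> bool" where E: "symp E" "irreflp E"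
      "\<And>v. v \<in> {0..<q} \<Longrightarrow> card (nbrs {0..<q} E v) \<le> d - 3"
      "(d - 3) * card {0..<q} \<le> (\<Sum>v\<in>{0..<q}. card (nbrs {0..<q} E v)) + 1"
    using near_regular_exists[OF finite_atLeastLessThan D] by blast
  have "spider_free d {0..<q} E"
    using E d by (intro spider_free_low_degree) force+
  then have "min_defect d (card {0..<q}) \<le> defect d {0..<q} E"
    using E d by (intro min_defect_le) auto
  moreover have "(int d - 3) * int q \<le> int (\<Sum>v\<in>{0..<q}. card (nbrs {0..<q} E v)) + 1"
  proof -
    have "int ((d - 3) * q) \<le> int ((\<Sum>v\<in>{0..<q}. card (nbrs {0..<q} E v)) + 1)"
      using E(4) by (simp only: of_nat_le_iff card_atLeastLessThan diff_zero)
    then show ?thesis using d by (simp add: of_nat_diff)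
  qed
  ultimately show ?thesis unfolding defect_eq by (simp add: algebra_simps)
qed

text \<open>The extremal example joins an independent set of size \<open>i = q - (d - 2)\<close> completely to a
  nearly \<open>(d - 3 - i)\<close>-regular graph on \<open>d - 2\<close> vertices.\<close>

lemma min_defect_join:
  assumes d: "d \<ge> 5" and q: "d - 1 \<le> q" "q \<le> 2 * d - 4"
  shows "min_defect d q \<le> int q + int d"
proof -
  define i where "i = q - (d - 2)"
  \<comment> \<open>With the \<open>i\<close> join edges a vertex of \<open>?N\<close> gets degree
    at most \<open>d - 3\<close>. For \<open>i = d - 2\<close> the subtraction truncates to
    \<open>0\<close>; the graph is then complete bipartite with all degrees \<open>d - 2\<close>,
    and non-neighbours of a vertex are independent.\<close>
  define D where "D = d - 3 - i"
  have i: "1 \<le> i" "i \<le> d - 2" "q = i + (d - 2)" using q d by (auto simp: i_def)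
  let ?I = "{0..<i}" and ?N = "{0..<d - 2}"
  have D: "D < card ?N" using d by (simp add: D_def)
  obtain F :: "nat \<Rightarrow> nat \<Rightarrow> bool" where F: "symp F" "irreflp F"
      "\<And>v. v \<in> ?N \<Longrightarrow> card (nbrs ?N F v) \<le> D"
      "D * card ?N \<le> (\<Sum>v\<in>?N. card (nbrs ?N F v)) + 1"
    using near_regular_exists[OF finite_atLeastLessThan D]
    by blast
  let ?V = "?I <+> ?N" and ?E = "sum_rel (\<lambda>_ _ :: nat. False) F True"
  have e: "nbrs ?I (\<lambda>_ _. False) x = {}" for x by auto
  have cl: "card (nbrs ?V ?E (Inl x)) = d - 2" and cr: "card (nbrs ?V ?E (Inr y)) = i + card (nbrs ?N F y)"
    for x y by (simp_all add: nbrs_sum_rel e card_Plus)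
  have sE: "symp ?E" and iE: "irreflp ?E"
    using F by (simp_all add: symp_sum_rel irreflp_sum_rel symp_def[of "\<lambda>_ _. False"]
        irreflp_def[of "\<lambda>_ _. False"])
  have "spider_free d ?V ?E"
  proof (rule spider_free_low_degree[OF _ iE sE d])
    fix v assume v: "v \<in> ?V"
    show "card (nbrs ?V ?E v) + 3 \<le> d \<or> (card (nbrs ?V ?E v) + 2 \<le> d \<and>
      (\<forall>x\<in>?V. \<forall>y\<in>?V. \<not> ?E v x \<longrightarrow> \<not> ?E v y \<longrightarrow> \<not> ?E x y))"
    proof (cases v)
      case (Inl x)
      then show ?thesis using cl d by auto
    next
      case (Inr y)
      then have y: "y \<in> ?N" using v by auto
      show ?thesis
      proof (cases "i = d - 2")
        case True
        then have "D = 0" by (simp add: D_def)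
        then have e: "nbrs ?N F z = {}" if "z \<in> ?N" for z
          using F(3)[OF that] by simp
        then have nF: "\<not> F z w" if "z \<in> ?N" "w \<in> ?N" for z w
          using that by (auto simp: nbrs_def)
        have "card (nbrs ?V ?E v) = d - 2"
          unfolding Inr cr e[OF y] using True by simp
        moreover have "\<not> ?E x z" if "x \<in> ?V" "z \<in> ?V" "\<not> ?E v x" "\<not> ?E v z" for x z
          using that nF unfolding Inr by (cases x; cases z) auto
        ultimately show ?thesis using d by auto
      next
        case False
        then show ?thesis unfolding Inr cr using F(3)[OF y] i d by (auto simp: D_def)
      qed
    qed
  qed simp
  then have "min_defect d (card ?V) \<le> defect d ?V ?E"
    using d by (intro min_defect_le sE iE) auto
  moreover have "card ?V = q" using i by (simp add: card_Plus)
  moreover have "int (\<Sum>v\<in>?V. card (nbrs ?V ?E v)) = 2 * int i * (int d - 2) + int (\<Sum>v\<in>?N. card (nbrs ?N F v))"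
  proof -
    have "(\<Sum>v\<in>?V. card (nbrs ?V ?E v)) = 2 * (i * (d - 2)) + (\<Sum>v\<in>?N. card (nbrs ?N F v))"
      by (simp add: sum_Plus' cl cr sum.distrib mult.commute)
    then show ?thesis using d by (simp only: of_nat_add of_nat_mult) (simp add: of_nat_diff)
  qed
  moreover have "int D * (int d - 2) \<le> int (\<Sum>v\<in>?N. card (nbrs ?N F v)) + 1"
  proof -
    have "int (D * (d - 2)) \<le> int ((\<Sum>v\<in>?N. card (nbrs ?N F v)) + 1)"
      using F(4) by (simp only: of_nat_le_iff card_atLeastLessThan diff_zero)
    then show ?thesis using d by (simp add: of_nat_diff)
  qed
  \<comment> \<open>In total: deficiency one on the \<open>i\<close> independent vertices, at most
    two on the \<open>d - 2\<close> others, and one for the parity loss, that is at most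
    \<open>i + 2 * (d - 2) + 1 = q + d - 1\<close>.\<close>
  ultimately have *: "min_defect d q \<le> (int d - 1) * int q - 2 * int i * (int d - 2) - int D * (int d - 2) + 1"
    unfolding defect_eq by simp
  have iq: "int i = int q - (int d - 2)" using i d by (simp add: of_nat_diff)
  have "int D * (int d - 2) \<ge> (int d - 3 - int i) * (int d - 2)"
    using d i by (intro mult_right_mono) (auto simp: D_def)
  with * show ?thesis by (simp add: iq algebra_simps)
qed

section \<open>Connected graphs on more than d vertices\<close>

text \<open>Double counting of the adjacent pairs in the product of \<open>A\<close> and
  \<open>B\<close>.\<close>

lemma card_nbrs_swap:
  assumes "symp E" "finite A" "finite B"
  shows "(\<Sum>a\<in>A. card (nbrs B E a)) = (\<Sum>b\<in>B. card (nbrs A E b))"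
proof -
  have c: "card (nbrs X E x) = (\<Sum>y\<in>X. if E x y then 1 else 0)" if "finite X" for X x
    using that by (simp add: nbrs_def sum.If_cases Int_def)
  have eq: "E x y = E y x" for x y using sympD[OF assms(1)] by blast
  have "(\<Sum>a\<in>A. card (nbrs B E a)) = (\<Sum>a\<in>A. \<Sum>b\<in>B. if E a b then 1 else 0)"
    using assms(3) by (simp only: c)
  also have "\<dots> = (\<Sum>b\<in>B. \<Sum>a\<in>A. if E a b then 1 else 0)" by (rule sum.swap)
  also have "\<dots> = (\<Sum>b\<in>B. \<Sum>a\<in>A. if E b a then 1 else 0)" by (simp only: eq)
  also have "\<dots> = (\<Sum>b\<in>B. card (nbrs A E b))"
    using assms(2) by (simp only: c)
  finally show ?thesis .
qed

lemma card_nbrs_Un: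
  assumes "finite A" "finite B" "A \<inter> B = {}"
  shows "card (nbrs (A \<union> B) E x) = card (nbrs A E x) + card (nbrs B E x)"
proof -
  have "nbrs (A \<union> B) E x = nbrs A E x \<union> nbrs B E x" by (auto simp: nbrs_def)
  then show ?thesis
    using assms by (simp, intro card_Un_disjoint) (auto simp: nbrs_def)
qed

lemma card_le_Diff_add: "finite B \<Longrightarrow> card A \<le> card (A - B) + card B"
  using diff_card_le_card_Diff[of B A] by linarith

text \<open>Connectedness without walks, in the form in which it is applied: a nonempty set closed
  under adjacency is everything.\<close>

definition connected_on :: "'a set \<Rightarrow> ('a \<Rightarrow> 'a \<Rightarrow> bool) \<Rightarrow> bool" where
  "connected_on V E \<longleftrightarrow>
     (\<forall>U \<subseteq> V. U \<noteq> {} \<longrightarrow> (\<forall>u\<in>U. nbrs V E u \<subseteq> U) \<longrightarrow> U = V)"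

lemma connected_onD:
  "connected_on V E \<Longrightarrow> U \<subseteq> V \<Longrightarrow> u \<in> U \<Longrightarrow> (\<And>u. u \<in> U \<Longrightarrow> nbrs V E u \<subseteq> U) \<Longrightarrow> U = V"
  unfolding connected_on_def by blast

text \<open>A nonempty set closed under adjacency of least cardinality is a component.\<close>

lemma connected_on_component:
  assumes "finite V" "V \<noteq> {}"
  obtains C where "C \<subseteq> V" "C \<noteq> {}" "connected_on C E" "\<And>v. v \<in> C \<Longrightarrow> nbrs V E v \<subseteq> C"
proof -
  define P where "P C \<longleftrightarrow> C \<subseteq> V \<and> C \<noteq> {} \<and> (\<forall>v\<in>C. nbrs V E v \<subseteq> C)" for C
  have "P V" using assms nbrs_subset by (auto simp: P_def)
  then obtain C where C: "P C" and least: "\<And>U. P U \<Longrightarrow> card C \<le> card U"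
    using ex_has_least_nat[of P V card] by blast
  have finC: "finite C" using C assms(1) finite_subset unfolding P_def by blast
  have "connected_on C E"
    unfolding connected_on_def
  proof (intro allI impI)
    fix U assume U: "U \<subseteq> C" "U \<noteq> {}" "\<forall>u\<in>U. nbrs C E u \<subseteq> U"
    have "P U"
      unfolding P_def
    proof (intro conjI ballI)
      fix u assume "u \<in> U"
      then have "nbrs V E u \<subseteq> C" using C U(1) unfolding P_def by blast
      then have "nbrs V E u \<subseteq> nbrs C E u" by (auto simp: nbrs_def)
      then show "nbrs V E u \<subseteq> U" using U(3) \<open>u \<in> U\<close> by blast
    qed (use C U in \<open>auto simp: P_def\<close>)
    then show "U = C" using least[of U] card_seteq[OF finC U(1)] by simp
  qed
  then show ?thesis using that C unfolding P_def by blast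
qed

text \<open>By \<open>step\<close>, vertices at distance two from \<open>v\<close> have no
  neighbours outside \<open>N\<close>. Hence the ball of radius two around \<open>v\<close> is
  closed under adjacency and, by connectedness, is all of \<open>V\<close>.\<close>

lemma all_near:
  assumes "connected_on V E" "symp E" "v \<in> V"
    and N: "N = nbrs V E v" and W: "W = V - insert v N"
    and step: "\<And>a w. a \<in> N \<Longrightarrow> w \<in> W \<Longrightarrow> E a w \<Longrightarrow> nbrs V E w \<subseteq> N"
    and w: "w \<in> W"
  shows "nbrs V E w \<subseteq> N" "\<exists>a\<in>N. E a w"
proof -
  define U where "U = insert v N \<union> {w \<in> W. \<exists>a\<in>N. E a w}"
  have "U = V"
  proof (rule connected_onD[OF assms(1)])
    show "U \<subseteq> V" using assms(3) by (auto simp: U_def N W)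
    show "v \<in> U" by (simp add: U_def)
    show "nbrs V E u \<subseteq> U" if "u \<in> U" for u
    proof -
      consider "u = v" | "u \<in> N" | "u \<in> W" "\<exists>a\<in>N. E a u" using \<open>u \<in> U\<close> by (auto simp: U_def)
      then show ?thesis
      proof cases
        case 1
        then show ?thesis by (auto simp: U_def N)
      next
        case 2
        then show ?thesis by (auto simp: U_def W)
      next
        case 3
        then show ?thesis using step[of _ u] by (auto simp: U_def)
      qed
    qed
  qed
  then show "\<exists>a\<in>N. E a w" using w by (auto simp: U_def W)
  then show "nbrs V E w \<subseteq> N" using step w by blast
qed

text \<open>A vertex of degree \<open>d - 2\<close> forces its set of non-neighbours to be independent, so every
  edge has an end in its neighbourhood.\<close>

lemma sum_nbrs_degree_d_minus_2:
  assumes fin: "finite V" and sym: "symp E" and irr: "irreflp E" and conn: "connected_on V E"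
    and sf: "spider_free d V E" and v: "v \<in> V" "card (nbrs V E v) + 2 = d"
    and max: "\<And>x. x \<in> V \<Longrightarrow> card (nbrs V E x) + 2 \<le> d"
  shows "(\<Sum>x\<in>V. card (nbrs V E x)) \<le> 2 * ((d - 2) * (d - 2))"
proof -
  define N where "N = nbrs V E v"
  define W where "W = V - insert v N"
  have finN: "finite N" using fin by (simp add: N_def)
  have NV: "N \<subseteq> V" by (auto simp: N_def)
  have vN: "v \<notin> N" using irreflpD[OF irr] by (simp add: N_def)
  \<comment> \<open>A neighbour \<open>x\<close> of \<open>w\<close> outside \<open>N\<close> would
    give the leg \<open>v, a, w, x\<close>, which uses only the neighbour \<open>a\<close> of
    \<open>v\<close> and leaves \<open>d - 3\<close> leaves.\<close>
  have step: "nbrs V E w \<subseteq> N" if "a \<in> N" "w \<in> W" "E a w" for a w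
  proof
    fix x assume x: "x \<in> nbrs V E w"
    show "x \<in> N"
    proof (rule ccontr)
      assume xN: "x \<notin> N"
      have "\<not> E v w" "w \<in> V" "w \<noteq> v" "w \<notin> N" using that by (auto simp: W_def N_def)
      then have "x \<noteq> v" using x sympD[OF sym, of w v] by auto
      have "x \<noteq> a" using xN that by blast
      have "card (N - {a, w, x}) + 3 < d"
        unfolding N_def using that x \<open>x \<noteq> v\<close> \<open>x \<noteq> a\<close> \<open>w \<in> V\<close> \<open>w \<noteq> v\<close> v NV
        by (intro spider_freeD[OF sf]) (auto simp: N_def)
      moreover have "N - {a, w, x} = N - {a}" using \<open>w \<notin> N\<close> xN by blast
      moreover have "card (N - {a}) = card N - 1" using that finN by simp
      ultimately show False using v(2) by (simp add: N_def)
    qed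
  qed
  define I where "I = V - N"
  have "nbrs V E w \<subseteq> N" if "w \<in> I" for w
  proof (cases "w = v")
    case False
    then have "w \<in> W" using that by (auto simp: I_def W_def)
    with step show ?thesis by (rule all_near(1)[OF conn sym v(1) N_def W_def])
  qed (simp add: N_def)
  then have "nbrs V E w = nbrs N E w" if "w \<in> I" for w
    using that NV by (auto simp: nbrs_def)
  \<comment> \<open>As \<open>I\<close> is independent, its degree sum counts the edges between
    \<open>I\<close> and \<open>N\<close>. It is at most the degree sum of \<open>N\<close>, hence
    at most \<open>(d - 2) * (d - 2)\<close>, and the total is at most twice that.\<close>
  then have "(\<Sum>w\<in>I. card (nbrs V E w)) = (\<Sum>w\<in>I. card (nbrs N E w))" by simp
  also have "\<dots> = (\<Sum>a\<in>N. card (nbrs I E a))"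
    using fin finN by (intro card_nbrs_swap sym) (simp_all add: I_def)
  also have "\<dots> \<le> (\<Sum>a\<in>N. card (nbrs V E a))"
    using fin by (intro sum_mono card_mono) (auto simp: I_def)
  finally have "(\<Sum>w\<in>I. card (nbrs V E w)) \<le> (\<Sum>a\<in>N. card (nbrs V E a))" .
  moreover have "(\<Sum>x\<in>V. card (nbrs V E x)) =
      (\<Sum>w\<in>I. card (nbrs V E w)) + (\<Sum>a\<in>N. card (nbrs V E a))"
    unfolding I_def using fin NV by (rule sum.subset_diff[rotated])
  moreover have "(\<Sum>a\<in>N. card (nbrs V E a)) \<le> (\<Sum>a\<in>N. d - 2)"
    using max NV by (intro sum_mono) (metis add_le_imp_le_diff subsetD)
  moreover have "card N = d - 2" using v(2) by (simp add: N_def)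
  ultimately show ?thesis by simp
qed

text \<open>A vertex of degree at least \<open>d - 1\<close> still has \<open>d - 3\<close> leaves
  after losing two neighbours, so a vertex of \<open>W\<close> adjacent to \<open>a\<close> in
  \<open>N\<close> has no other neighbour. All of \<open>W\<close> is thus pendant; its edges,
  counted at both ends, give \<open>2 * card W\<close>, and \<open>card N\<close> is the degree of
  \<open>v\<close>.\<close>

lemma nonneighbours_pendant:
  assumes fin: "finite V" and sym: "symp E" and irr: "irreflp E" and conn: "connected_on V E"
    and sf: "spider_free d V E" and v: "v \<in> V" "d \<le> card N + 1"
    and N: "N = nbrs V E v" and W: "W = V - insert v N"
  shows "w \<in> W \<Longrightarrow> \<exists>a\<in>N. E a w"
    and "(\<Sum>x\<in>V. card (nbrs V E x)) \<le>
      card N + 2 * card W + (\<Sum>a\<in>N. card (nbrs (insert v N) E a))"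
proof -
  have finN: "finite N" and finW: "finite W" using fin by (simp_all add: N W)
  have NV: "N \<subseteq> V" by (auto simp: N)
  have vN: "v \<notin> N" using irreflpD[OF irr] by (simp add: N)
  have step: "nbrs V E w \<subseteq> {a}" if "a \<in> N" "w \<in> W" "E a w" for a w
  proof
    fix x assume x: "x \<in> nbrs V E w"
    show "x \<in> {a}"
    proof (rule ccontr)
      assume "x \<notin> {a}"
      then have "x \<noteq> a" by simp
      have "\<not> E v w" "w \<in> V" "w \<noteq> v" "w \<notin> N" using that by (auto simp: W N)
      then have "x \<noteq> v" using x sympD[OF sym, of w v] by auto
      have "card (N - {a, w, x}) + 3 < d"
        unfolding N using that x \<open>x \<noteq> v\<close> \<open>x \<noteq> a\<close> \<open>w \<in> V\<close> \<open>w \<noteq> v\<close> v NV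
        by (intro spider_freeD[OF sf]) (auto simp: N)
      moreover have "N - {a, w, x} = N - {a, x}" using \<open>w \<notin> N\<close> by blast
      moreover have "card N \<le> card (N - {a, x}) + card {a, x}" by (rule card_le_Diff_add) simp
      moreover have "card {a, x} = 2" using \<open>x \<noteq> a\<close> by simp
      ultimately show False using v(2) by simp
    qed
  qed
  have step': "nbrs V E w \<subseteq> N" if "a \<in> N" "w \<in> W" "E a w" for a w
    using step[OF that] that(1) by blast
  show near: "\<exists>a\<in>N. E a w" if "w \<in> W" for w
    using all_near(2)[OF conn sym v(1) N W step' that] .
  have pend: "card (nbrs V E w) \<le> 1" if w: "w \<in> W" for w
  proof -
    obtain a where "a \<in> N" "E a w" using near[OF w] by blast
    then have "nbrs V E w \<subseteq> {a}" using step w by blast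
    then have "card (nbrs V E w) \<le> card {a}" by (intro card_mono) auto
    then show ?thesis by simp
  qed
  have "(\<Sum>a\<in>N. card (nbrs W E a)) = (\<Sum>w\<in>W. card (nbrs N E w))"
    by (rule card_nbrs_swap[OF sym finN finW])
  also have "\<dots> \<le> (\<Sum>w\<in>W. card (nbrs V E w))"
    using fin NV by (intro sum_mono card_mono) (auto simp: nbrs_def)
  finally have NW: "(\<Sum>a\<in>N. card (nbrs W E a)) \<le> (\<Sum>w\<in>W. card (nbrs V E w))" .
  have Wle: "(\<Sum>w\<in>W. card (nbrs V E w)) \<le> card W"
    using sum_mono[of W "\<lambda>w. card (nbrs V E w)" "\<lambda>_. 1"] pend by simp
  have V: "V = insert v N \<union> W" using v NV by (auto simp: W)
  have disj: "insert v N \<inter> W = {}" by (auto simp: W)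
  have "(\<Sum>x\<in>V. card (nbrs V E x)) =
      (\<Sum>x\<in>insert v N. card (nbrs V E x)) + (\<Sum>w\<in>W. card (nbrs V E w))"
    using sum.union_disjoint[of "insert v N" W "\<lambda>x. card (nbrs V E x)"] finN finW disj V by simp
  also have "(\<Sum>x\<in>insert v N. card (nbrs V E x)) = card N + (\<Sum>a\<in>N. card (nbrs V E a))"
    using finN vN by (simp add: N)
  also have "(\<Sum>a\<in>N. card (nbrs V E a)) =
      (\<Sum>a\<in>N. card (nbrs (insert v N) E a)) + (\<Sum>a\<in>N. card (nbrs W E a))"
    using card_nbrs_Un[of "insert v N" W E] finN finW disj V by (simp add: sum.distrib)
  finally show "(\<Sum>x\<in>V. card (nbrs V E x)) \<le>
      card N + 2 * card W + (\<Sum>a\<in>N. card (nbrs (insert v N) E a))"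
    using NW Wle by linarith
qed

lemma card_split_at:
  assumes "finite V" "irreflp E" "v \<in> V"
  shows "card V = 1 + card (nbrs V E v) + card (V - insert v (nbrs V E v))"
proof -
  have "card (insert v (nbrs V E v)) = 1 + card (nbrs V E v)"
    using assms irreflpD[OF assms(2)] by simp
  moreover have "insert v (nbrs V E v) \<subseteq> V" using assms by auto
  ultimately show ?thesis
    using assms(1) card_Diff_subset[of "insert v (nbrs V E v)" V] card_mono[of V "insert v (nbrs V E v)"]
    by simp
qed

text \<open>Since \<open>V\<close> has more than \<open>d\<close> vertices, a pendant vertex
  \<open>w\<close> hangs on some \<open>a\<close> in \<open>N\<close>. An edge \<open>ax\<close>
  inside \<open>N\<close> would give the leg \<open>v, x, a, w\<close>. So within the closed
  neighbourhood of \<open>v\<close> the vertex \<open>a\<close> has degree at most one and each of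
  the other \<open>d - 2\<close> vertices of \<open>N\<close> has degree at most
  \<open>d - 2\<close>.\<close>

lemma sum_nbrs_degree_d_minus_1:
  assumes fin: "finite V" and sym: "symp E" and irr: "irreflp E" and conn: "connected_on V E"
    and sf: "spider_free d V E" and v: "v \<in> V" "card (nbrs V E v) + 1 = d"
    and big: "d < card V"
  shows "(\<Sum>x\<in>V. card (nbrs V E x)) + d \<le> 2 * card V + (d - 2) * (d - 2)"
proof -
  define N where "N = nbrs V E v"
  define W where "W = V - insert v N"
  have finN: "finite N" using fin by (simp add: N_def)
  have NV: "N \<subseteq> V" by (auto simp: N_def)
  have vN: "v \<notin> N" using irreflpD[OF irr] by (simp add: N_def)
  have cN: "card N + 1 = d" using v by (simp add: N_def)
  have cV: "card V = d + card W"
    using card_split_at[OF fin irr v(1)] cN by (simp add: N_def W_def)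
  then obtain w where w: "w \<in> W" using big by fastforce
  have dN: "d \<le> card N + 1" using cN by simp
  note pend = nonneighbours_pendant[OF fin sym irr conn sf v(1) dN N_def W_def]
  obtain a where a: "a \<in> N" "E a w" using pend(1)[OF w] by blast
  have wVN: "w \<in> V" "w \<noteq> v" "w \<notin> N" using w by (auto simp: W_def)
  have noN: "\<not> E a x" if x: "x \<in> N" for x
  proof
    assume "E a x"
    then have xa: "E x a" "x \<noteq> a" using sympD[OF sym] irreflpD[OF irr] by blast+
    have "w \<noteq> x" "a \<noteq> v" using x wVN a vN by blast+
    have "card (N - {x, a, w}) + 3 < d"
      unfolding N_def using x xa a wVN v NV \<open>w \<noteq> x\<close> \<open>a \<noteq> v\<close>
      by (intro spider_freeD[OF sf]) (auto simp: N_def)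
    moreover have "N - {x, a, w} = N - {x, a}" using wVN by blast
    moreover have "card N \<le> card (N - {x, a}) + card {x, a}" by (rule card_le_Diff_add) simp
    moreover have "card {x, a} = 2" using xa by simp
    ultimately show False using cN by simp
  qed
  have "nbrs (insert v N) E a \<subseteq> {v}" using noN by auto
  then have "card (nbrs (insert v N) E a) \<le> card {v}" by (intro card_mono) auto
  then have ca: "card (nbrs (insert v N) E a) \<le> 1" by simp
  have cx: "card (nbrs (insert v N) E x) \<le> d - 2" if x: "x \<in> N - {a}" for x
  proof -
    have "\<not> E x a" using noN[of x] x sympD[OF sym] by blast
    then have "nbrs (insert v N) E x \<subseteq> insert v N - {a, x}" using irreflpD[OF irr] by auto
    then have "card (nbrs (insert v N) E x) \<le> card (insert v N - {a, x})"
      using finN by (intro card_mono) auto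
    also have "\<dots> = card (insert v N) - card {a, x}"
      using a x by (intro card_Diff_subset) auto
    also have "card {a, x} = 2" using x by auto
    finally show ?thesis using finN vN cN by simp
  qed
  have "(\<Sum>x\<in>N. card (nbrs (insert v N) E x)) =
      card (nbrs (insert v N) E a) + (\<Sum>x\<in>N - {a}. card (nbrs (insert v N) E x))"
    by (rule sum.remove[OF finN a(1)])
  also have "(\<Sum>x\<in>N - {a}. card (nbrs (insert v N) E x)) \<le> (\<Sum>x\<in>N - {a}. d - 2)"
    by (rule sum_mono) (rule cx)
  also have "\<dots> = (d - 2) * (d - 2)" using a finN by (simp add: cN[symmetric])
  finally show ?thesis using pend(2) ca cN cV by linarith
qed

text \<open>Now three neighbours of \<open>v\<close> can be spared, so a leg
  \<open>v, x, a, y\<close> with \<open>x, a, y\<close> in \<open>N\<close> is impossible. Hence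
  \<open>N\<close> spans a matching, and its vertices have degree at most two in the closed
  neighbourhood.\<close>

lemma sum_nbrs_degree_ge_d:
  assumes fin: "finite V" and sym: "symp E" and irr: "irreflp E" and conn: "connected_on V E"
    and sf: "spider_free d V E" and v: "v \<in> V" "d \<le> card (nbrs V E v)"
  shows "(\<Sum>x\<in>V. card (nbrs V E x)) + 3 \<le> 3 * card V"
proof -
  define N where "N = nbrs V E v"
  define W where "W = V - insert v N"
  have finN: "finite N" using fin by (simp add: N_def)
  have NV: "N \<subseteq> V" by (auto simp: N_def)
  have vN: "v \<notin> N" using irreflpD[OF irr] by (simp add: N_def)
  have cN: "d \<le> card N" using v by (simp add: N_def)
  have cV: "card V = 1 + card N + card W"
    using card_split_at[OF fin irr v(1)] by (simp add: N_def W_def)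
  have dN: "d \<le> card N + 1" using cN by simp
  note pend = nonneighbours_pendant(2)[OF fin sym irr conn sf v(1) dN N_def W_def]
  have cx: "card (nbrs (insert v N) E a) \<le> 2" if a: "a \<in> N" for a
  proof -
    have "x = y" if xy: "x \<in> nbrs N E a" "y \<in> nbrs N E a" for x y
    proof (rule ccontr)
      assume "x \<noteq> y"
      have "E x a" using xy sympD[OF sym] by auto
      have "a \<noteq> v" "y \<noteq> v" using a xy vN by auto
      have "card (N - {x, a, y}) + 3 < d"
        unfolding N_def using a xy \<open>x \<noteq> y\<close> \<open>E x a\<close> \<open>a \<noteq> v\<close> \<open>y \<noteq> v\<close> v NV
        by (intro spider_freeD[OF sf]) (auto simp: N_def)
      moreover have "card N \<le> card (N - {x, a, y}) + card {x, a, y}"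
        by (rule card_le_Diff_add) simp
      moreover have "card {x, a, y} \<le> 3" by (simp add: card_insert_if)
      ultimately show False using cN by linarith
    qed
    then have "card (nbrs N E a) \<le> 1"
      using finN by (simp add: card_le_Suc0_iff_eq)
    moreover have "nbrs (insert v N) E a \<subseteq> insert v (nbrs N E a)" by auto
    then have "card (nbrs (insert v N) E a) \<le> card (insert v (nbrs N E a))"
      using finN by (intro card_mono) auto
    moreover have "card (insert v (nbrs N E a)) \<le> card (nbrs N E a) + 1"
      using finN by (simp add: card_insert_if)
    ultimately show ?thesis by linarith
  qed
  have "(\<Sum>a\<in>N. card (nbrs (insert v N) E a)) \<le> (\<Sum>a\<in>N. 2)"
    by (rule sum_mono) (rule cx)
  then show ?thesis using pend cV by simp
qed

text \<open>The alternatives belong, in this order, to maximum degree at most \<open>d - 3\<close>,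
  equal to \<open>d - 2\<close>, equal to \<open>d - 1\<close>, and at least
  \<open>d\<close>.\<close>

lemma connected_defect:
  assumes fin: "finite V" and sym: "symp E" and irr: "irreflp E" and conn: "connected_on V E"
    and sf: "spider_free d V E" and big: "d < card V" and d: "d \<ge> 5"
  defines "D \<equiv> int d" and "m \<equiv> int (card V)" and "\<delta> \<equiv> defect d V E"
  shows "2 * m \<le> \<delta> \<or> (m \<le> \<delta> \<and> (D - 1) * m - 2 * ((D - 2) * (D - 2)) \<le> \<delta>) \<or>
    (D - 3) * m - D * D + 5 * D - 4 \<le> \<delta> \<or> (D - 4) * m + 3 \<le> \<delta>"
proof -
  define S where "S = (\<Sum>x\<in>V. card (nbrs V E x))"
  have dl: "\<delta> = (D - 1) * m - int S" by (simp add: defect_eq D_def m_def \<delta>_def S_def)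
  have uniform: "int S \<le> (D - int j) * m" if "\<And>x. x \<in> V \<Longrightarrow> card (nbrs V E x) + j \<le> d" for j
  proof -
    have "int S = (\<Sum>x\<in>V. int (card (nbrs V E x)))" by (simp add: S_def)
    also have "\<dots> \<le> (\<Sum>x\<in>V. D - int j)" using that by (intro sum_mono) (force simp: D_def)
    finally show ?thesis by (simp add: m_def mult.commute)
  qed
  have sq: "int ((d - 2) * (d - 2)) = (D - 2) * (D - 2)"
    using d by (simp add: D_def of_nat_diff)
  show ?thesis
  proof (cases "\<exists>v\<in>V. d \<le> card (nbrs V E v)")
    case True
    then have "S + 3 \<le> 3 * card V"
      using sum_nbrs_degree_ge_d[OF fin sym irr conn sf] unfolding S_def by blast
    then have "int S + 3 \<le> 3 * m" by (simp add: m_def)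
    then have "(D - 4) * m + 3 \<le> \<delta>" unfolding dl by (simp add: algebra_simps)
    then show ?thesis by blast
  next
    case no1: False
    show ?thesis
    proof (cases "\<exists>v\<in>V. card (nbrs V E v) + 1 = d")
      case True
      then have "S + d \<le> 2 * card V + (d - 2) * (d - 2)"
        using sum_nbrs_degree_d_minus_1[OF fin sym irr conn sf _ _ big] unfolding S_def by blast
      then have "int (S + d) \<le> int (2 * card V + (d - 2) * (d - 2))" by (simp only: of_nat_le_iff)
      then have "int S + D \<le> 2 * m + (D - 2) * (D - 2)"
        using sq by (simp add: D_def m_def)
      then have "(D - 3) * m - D * D + 5 * D - 4 \<le> \<delta>" unfolding dl by (simp add: algebra_simps)
      then show ?thesis by blast
    next
      case no2: False
      have le2: "card (nbrs V E x) + 2 \<le> d" if "x \<in> V" for x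
      proof -
        have "\<not> d \<le> card (nbrs V E x)" "card (nbrs V E x) + 1 \<noteq> d" using that no1 no2 by blast+
        then show ?thesis by linarith
      qed
      show ?thesis
      proof (cases "\<exists>v\<in>V. card (nbrs V E v) + 2 = d")
        case True
        then have "S \<le> 2 * ((d - 2) * (d - 2))"
          using sum_nbrs_degree_d_minus_2[OF fin sym irr conn sf _ _ le2] unfolding S_def by blast
        then have "int S \<le> int (2 * ((d - 2) * (d - 2)))" by (simp only: of_nat_le_iff)
        then have "int S \<le> 2 * ((D - 2) * (D - 2))" using sq by simp
        moreover have "int S \<le> (D - 2) * m" using uniform[of 2] le2 by simp
        ultimately show ?thesis unfolding dl by (simp add: algebra_simps)
      next
        case False
        have "card (nbrs V E x) + 3 \<le> d" if "x \<in> V" for x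
          using le2[OF that] False that by (metis Suc_leI add_Suc_right eval_nat_numeral(3) le_neq_implies_less)
        then have "int S \<le> (D - 3) * m" using uniform[of 3] by simp
        then show ?thesis unfolding dl by (simp add: algebra_simps)
      qed
    qed
  qed
qed

section \<open>What is kept of a large component\<close>

lemma min_defect_antimono:
  assumes "d \<ge> 5"
  shows "min_defect d (q + d) \<le> min_defect d q"
  \<comment> \<open>The added part is a copy of K_d, of defect zero.\<close>
  using min_defect_add[OF assms, of q d] min_defect_small[OF assms, of d] by simp

text \<open>Needed because for \<open>d = 5\<close> a vertex of degree at least \<open>d\<close>
  only guarantees defect \<open>m + 3\<close>, too weak against the nearly regular bound. Here
  \<open>s * (5 - s)\<close> is at most \<open>6\<close>, and copies of K_5 carry this to every
  \<open>q\<close>.\<close>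

lemma min_defect_5_le: "min_defect 5 q \<le> 6"
proof (induction q rule: less_induct)
  case (less q)
  show ?case
  proof (cases "q < 5")
    case True
    then have "q \<in> {0, 1, 2, 3, 4}" by auto
    then have "int q * int (5 - q) \<le> 6" by auto
    then show ?thesis using min_defect_small[of 5 q] True by simp
  next
    case False
    then show ?thesis using min_defect_antimono[of 5 "q - 5"] less[of "q - 5"] by simp
  qed
qed

text \<open>The facts about a component with \<open>m\<close> vertices and defect
  \<open>\<delta>\<close> that the exchanges use. The clauses on \<open>m - d\<close> and
  \<open>m - 1\<close> split off K_d from it and fill up K_{d-1} with one of its vertices; the last
  one serves \<open>r = d - 3\<close> when there is no small part.\<close>

definition large :: "nat \<Rightarrow> nat \<Rightarrow> int \<Rightarrow> bool" where
  "large d m \<delta> \<longleftrightarrow> d < m \<and> int m \<le> \<delta> \<and> min_defect d m \<le> \<delta> \<and>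
     (2 * d \<le> m \<longrightarrow> min_defect d (m - d) \<le> \<delta>) \<and>
     min_defect d (m - 1) \<le> \<delta> + int d - 3 \<and>
     (m = 2 * d - 3 \<longrightarrow> 3 * int d - 9 \<le> \<delta>)"

text \<open>The deficiency of \<open>x\<close> disappears, and that of each of its neighbours grows
  by one.\<close>

lemma defect_remove_vertex:
  assumes "finite V" "symp E" "irreflp E" "x \<in> V"
  shows "defect d (V - {x}) E = defect d V E - (int d - 1) + 2 * int (card (nbrs V E x))"
proof -
  let ?V = "V - {x}"
  have V: "V = ?V \<union> {x}" using assms(4) by blast
  have nx: "nbrs V E x = nbrs ?V E x" using irreflpD[OF assms(3)] by (auto simp: nbrs_def)
  have "card (nbrs V E v) = card (nbrs ?V E v) + card (nbrs {x} E v)" for v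
    using card_nbrs_Un[of ?V "{x}" E v] assms(1) V by simp
  then have "(\<Sum>v\<in>?V. card (nbrs V E v)) =
      (\<Sum>v\<in>?V. card (nbrs ?V E v)) + (\<Sum>v\<in>?V. card (nbrs {x} E v))"
    by (simp add: sum.distrib)
  also have "(\<Sum>v\<in>?V. card (nbrs {x} E v)) = card (nbrs V E x)"
    using card_nbrs_swap[OF assms(2), of ?V "{x}"] assms(1) nx by simp
  also have "(\<Sum>v\<in>?V. card (nbrs V E v)) = (\<Sum>v\<in>V. card (nbrs V E v)) - card (nbrs V E x)"
    using sum.remove[OF assms(1,4), of "\<lambda>v. card (nbrs V E v)"] by simp
  finally have "int (\<Sum>v\<in>V. card (nbrs V E v)) =
      int (\<Sum>v\<in>?V. card (nbrs ?V E v)) + 2 * int (card (nbrs V E x))"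
    using sum.remove[OF assms(1,4), of "\<lambda>v. card (nbrs V E v)"] by linarith
  moreover have "int (card V) = int (card ?V) + 1"
    using assms(1,4) card.remove[of V x] by simp
  ultimately show ?thesis unfolding defect_eq by (simp add: algebra_simps)
qed

lemma large_connected:
  assumes fin: "finite V" and sym: "symp E" and irr: "irreflp E" and conn: "connected_on V E"
    and sf: "spider_free d V E" and big: "d < card V" and d: "d \<ge> 5"
  shows "large d (card V) (defect d V E)"
proof -
  define D where "D = int d"
  define m where "m = int (card V)"
  define \<delta> where "\<delta> = defect d V E"
  have D: "D \<ge> 5" and mD: "m \<ge> D + 1" using d big by (simp_all add: D_def m_def)
  consider (a) "2 * m \<le> \<delta>" | (b) "m \<le> \<delta>" "(D - 1) * m - 2 * ((D - 2) * (D - 2)) \<le> \<delta>"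
    | (c) "(D - 3) * m - D * D + 5 * D - 4 \<le> \<delta>" | (e) "(D - 4) * m + 3 \<le> \<delta>"
    using connected_defect[OF fin sym irr conn sf big d] unfolding D_def m_def \<delta>_def by blast
  note cases = this
  have ge_m: "m \<le> \<delta>"
    using cases
  proof cases
    case c
    have "0 \<le> (D - 4) * (m - (D + 1))" using D mD by (intro mult_nonneg_nonneg) auto
    then show ?thesis using c D by (simp add: algebra_simps)
  next
    case e
    have "0 \<le> (D - 5) * m" using D mD by (intro mult_nonneg_nonneg) auto
    then show ?thesis using e D by (simp add: algebra_simps)
  qed (use D mD in auto)
  have large2: "min_defect d (card V - d) \<le> \<delta>" if "2 * d \<le> card V"
  proof -
    have m2: "m \<ge> 2 * D" using that by (simp add: m_def D_def)
    \<comment> \<open>A nearly regular graph on \<open>m - d\<close> vertices reduces the goal to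
      \<open>2 * m - 2 * D + 1\<close> \<le> \<open>\<delta>\<close>. Only case \<open>e\<close>
      with \<open>d = 5\<close> has to be treated differently.\<close>
    have "min_defect d (card V - d) \<le> 2 * int (card V - d) + 1"
      using that by (intro min_defect_near_regular d) auto
    define h where "h = min_defect d (card V - d)"
    then have reg: "h \<le> 2 * m - 2 * D + 1"
      using \<open>min_defect d (card V - d) \<le> _\<close> that by (simp add: m_def D_def of_nat_diff)
    have "h \<le> \<delta>"
      using cases
    proof cases
      case a
      then show ?thesis using reg D by linarith
    next
      case b
      have "0 \<le> (D - 3) * (m - 2 * D)" using D m2 by (intro mult_nonneg_nonneg) auto
      then have "2 * m \<le> \<delta>" using b D by (simp add: algebra_simps)
      then show ?thesis using reg D by linarith
    next
      case c
      have "0 \<le> (D - 5) * (m - 2 * D)" using D m2 by (intro mult_nonneg_nonneg) auto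
      then have "2 * m + D * D - 5 * D - 4 \<le> \<delta>" using c by (simp add: algebra_simps)
      moreover define Q where "Q = D * D"
      moreover have "5 * D \<le> Q" unfolding Q_def using D by (intro mult_right_mono) auto
      ultimately have "2 * m - 4 \<le> \<delta>" by linarith
      then show ?thesis using reg D by linarith
    next
      case e
      show ?thesis
      proof (cases "d = 5")
        case True
        then show ?thesis using min_defect_5_le[of "card V - d"] e m2 by (simp add: D_def h_def)
      next
        case False
        then have "D \<ge> 6" using d by (simp add: D_def)
        then have "0 \<le> (D - 6) * m" using mD D by (intro mult_nonneg_nonneg) auto
        then have "2 * m \<le> \<delta>" using e by (simp add: algebra_simps)
        then show ?thesis using reg D by linarith
      qed
    qed
    then show ?thesis by (simp add: h_def)
  qed
  have "3 * D - 9 \<le> \<delta>" if "card V = 2 * d - 3"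
  proof -
    have m: "m = 2 * D - 3" using that d by (simp add: m_def D_def of_nat_diff)
    \<comment> \<open>For \<open>m = 2 * D - 3\<close> the bound of case \<open>e\<close> exceeds
      \<open>3 * D - 9\<close> by exactly twice this product, that of case \<open>c\<close> by the
      product plus two.\<close>
    have sq: "0 \<le> (D - 3) * (D - 4)" using D by (intro mult_nonneg_nonneg) auto
    show ?thesis
      using cases by cases (use sq D in \<open>auto simp: m algebra_simps\<close>)
  qed
  moreover have "min_defect d (card V - 1) \<le> \<delta> + D - 3"
  proof -
    \<comment> \<open>Otherwise no deficiency is positive, against \<open>m\<close> \<le>
      \<open>\<delta>\<close>. Deleting such a vertex raises the defect by at most
      \<open>2 * (d - 2) - (d - 1) = d - 3\<close>.\<close>
    have "\<exists>x\<in>V. card (nbrs V E x) + 2 \<le> d"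
    proof (rule ccontr)
      assume neg: "\<not> ?thesis"
      have "\<delta> \<le> (\<Sum>x\<in>V. 0)"
        unfolding \<delta>_def defect_def
      proof (rule sum_mono)
        fix x assume "x \<in> V"
        then have "\<not> card (nbrs V E x) + 2 \<le> d" using neg by blast
        then show "int d - 1 - int (card (nbrs V E x)) \<le> 0" by linarith
      qed
      then show False using ge_m mD D by simp
    qed
    then obtain x where x: "x \<in> V" "card (nbrs V E x) + 2 \<le> d" by blast
    have "min_defect d (card (V - {x})) \<le> defect d (V - {x}) E"
      using fin spider_free_mono[OF sf _ fin, of "V - {x}"]
      by (intro min_defect_le sym irr d) auto
    also have "\<dots> = \<delta> - (D - 1) + 2 * int (card (nbrs V E x))"
      unfolding \<delta>_def D_def by (rule defect_remove_vertex[OF fin sym irr x(1)])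
    finally show ?thesis using x fin by (simp add: D_def)
  qed
  moreover have "min_defect d (card V) \<le> \<delta>"
    unfolding \<delta>_def by (rule min_defect_le[OF sym irr fin sf d])
  ultimately show ?thesis
    using big ge_m large2 unfolding large_def by (simp add: D_def m_def \<delta>_def)
qed

section \<open>Exchanging components\<close>

text \<open>Merging K_s and K_t into K_{s+t} lowers the defect by \<open>2 * s * t\<close>.\<close>

lemma complete_defect_merge:
  assumes "s + t \<le> d"
  shows "int (s + t) * int (d - (s + t)) \<le> int s * int (d - s) + int t * int (d - t)"
  using assms by (simp add: of_nat_diff algebra_simps)

text \<open>Exchanging K_s and K_t for K_d and K_{s+t-d} lowers the defect by
  \<open>2 * (d - s) * (d - t)\<close>; this is the merging inequality for \<open>d - s\<close> and
  \<open>d - t\<close>.\<close>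

lemma complete_defect_overflow:
  assumes "s \<le> d" "t \<le> d" "d \<le> s + t"
  shows "int (s + t - d) * int (d - (s + t - d)) \<le> int s * int (d - s) + int t * int (d - t)"
proof -
  have "0 \<le> (int d - int s) * (int d - int t)" using assms by (intro mult_nonneg_nonneg) auto
  moreover have "int (s + t - d) = int s + int t - int d"
    "int (d - (s + t - d)) = 2 * int d - int s - int t"
    using assms by auto
  ultimately show ?thesis
    using assms by (simp add: of_nat_diff algebra_simps)
qed

lemma min_defect_overflow:
  assumes d: "d \<ge> 5" and "s \<le> d" "t \<le> d" "d \<le> s + t"
  shows "min_defect d (s + t - d) \<le> int s * int (d - s) + int t * int (d - t)"
  using min_defect_small[OF d, of "s + t - d"] complete_defect_overflow[of s d t] assms by linarith

text \<open>With \<open>q = m + l - d\<close> the target is \<open>q + d\<close>. The join reaches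
  it for \<open>q\<close> \<le> \<open>2 * d - 4\<close>. Beyond that K_d is split off once more and
  the remaining \<open>t\<close> vertices carry K_t, with \<open>d - t\<close> \<le>
  \<open>3\<close>, or a nearly regular graph, where \<open>t\<close> \<le>
  \<open>2 * d - 2\<close>.\<close>

lemma min_defect_two_large:
  assumes d: "d \<ge> 5" and m: "d < m" "m < 2 * d" and l: "d < l" "l < 2 * d"
  shows "min_defect d (m + l - d) \<le> int m + int l"
proof -
  define q where "q = m + l - d"
  have q: "d + 2 \<le> q" "q + 2 \<le> 3 * d" "int m + int l = int q + int d"
    using m l by (auto simp: q_def)
  have "min_defect d q \<le> int q + int d"
  proof (cases "q \<le> 2 * d - 4")
    case True
    then show ?thesis using min_defect_join[OF d, of q] q by simp
  next
    case False
    define t where "t = q - d"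
    have t: "q = t + d" using q by (simp add: t_def)
    have down: "min_defect d q \<le> min_defect d t"
      unfolding t by (rule min_defect_antimono[OF d])
    show ?thesis
    proof (cases "t < d")
      case True
      have "min_defect d t \<le> int t * int (d - t)"
        using True by (intro min_defect_small d) auto
      also have "\<dots> \<le> int t * 3"
        using False True t d by (intro mult_left_mono) auto
      finally show ?thesis using down True t by linarith
    next
      case ge: False
      have "min_defect d t \<le> 2 * int t + 1"
        using ge by (intro min_defect_near_regular d) auto
      then show ?thesis using down q(2) t by linarith
    qed
  qed
  then have "min_defect d q \<le> int m + int l" using q(3) by linarith
  then show ?thesis by (simp only: q_def)
qed

text \<open>For \<open>s = d - 1\<close> this is the vertex deletion clause of \<open>large\<close>.
  For smaller \<open>s\<close> the product is at least \<open>2 * s\<close>, which pays for a nearly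
  regular graph on \<open>m - (d - s)\<close> vertices.\<close>

lemma min_defect_large_small:
  assumes d: "d \<ge> 5" and L: "large d m \<delta>" and m: "m < 2 * d" and s: "s < d" "2 * d \<le> m + s"
  shows "min_defect d (m + s - d) \<le> \<delta> + int s * int (d - s)"
proof (cases "d - s = 1")
  case True
  then have "m + s - d = m - 1" "int s = int d - 1" using s by auto
  then show ?thesis using L True by (simp add: large_def)
next
  case False
  define y where "y = int d - int s"
  have y: "y \<ge> 2" "int s \<ge> 1" "int (d - s) = y" using False s m by (auto simp: y_def)
  have "min_defect d (m + s - d) \<le> 2 * int (m + s - d) + 1"
    using s by (intro min_defect_near_regular d) auto
  also have "int (m + s - d) = int m - y" using s by (simp add: y_def)
  also have "2 * (int m - y) + 1 \<le> \<delta> + int s * y"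
  proof -
    define z where "z = int s * y"
    have "int s * 2 \<le> z" unfolding z_def using y by (intro mult_left_mono) auto
    moreover have "int m + 1 \<le> 2 * y + 2 * int s" using m by (simp add: y_def)
    moreover have "int m \<le> \<delta>" using L by (simp add: large_def)
    ultimately have "2 * int m - 2 * y + 1 \<le> \<delta> + z" by linarith
    then show ?thesis by (simp add: z_def)
  qed
  finally show ?thesis by (simp only: y(3))
qed

text \<open>The product is concave in \<open>s\<close> and equals \<open>d - 1\<close> at both
  ends.\<close>

lemma complete_defect_ge:
  assumes "1 \<le> s" "s < d"
  shows "int d - 1 \<le> int s * int (d - s)"
proof -
  have "0 \<le> (int s - 1) * (int d - int s - 1)" using assms by (intro mult_nonneg_nonneg) auto
  then show ?thesis using assms by (simp add: of_nat_diff algebra_simps)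
qed

text \<open>The large part costs at least \<open>m\<close> > \<open>d\<close>, and a nonempty small
  part at least \<open>d - 1\<close> more. This settles \<open>r = d - 1\<close> and
  \<open>r = d - 2\<close>, where the targets are \<open>d - 1\<close> and
  \<open>2 * d - 4\<close>.\<close>

lemma large_small_base:
  assumes d: "d \<ge> 5" and L: "large d m \<delta>" and ms: "m + s = d + r"
    and r: "r \<in> {d - 3, d - 2, d - 1}"
  shows "int r * int (d - r) \<le> \<delta> + int s * int (d - s)"
proof -
  have m: "d < m" "int m \<le> \<delta>" using L by (simp_all add: large_def)
  have s: "s < d" using ms m r d by auto
  define q where "q = int s * int (d - s)"
  have "int d - 1 \<le> q" if "s \<noteq> 0"
    unfolding q_def using that s by (intro complete_defect_ge) auto
  then have g: "s = 0 \<or> int d - 1 \<le> q" by blast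
  have q0: "q \<ge> 0" by (simp add: q_def)
  consider "r = d - 1" | "r = d - 2" | "r = d - 3" using r by blast
  then have "int r * int (d - r) \<le> \<delta> + q"
  proof cases
    case 1
    then have "int r * int (d - r) = int d - 1" using d by (simp add: of_nat_diff)
    then show ?thesis using m q0 by linarith
  next
    case 2
    then have "int r * int (d - r) = 2 * int d - 4" using d by (simp add: of_nat_diff)
    moreover have "int m + int s = 2 * int d - 2" using 2 ms d by (simp add: of_nat_diff)
    ultimately show ?thesis using m q0 g by linarith
  next
    case 3
    then have e: "int r * int (d - r) = 3 * int d - 9" using d by (simp add: of_nat_diff)
    have m': "int m + int s = 2 * int d - 3" using 3 ms d by (simp add: of_nat_diff)
    show ?thesis
    proof (cases "s = 0")
      case True
      then have "m = 2 * d - 3" using m' d by (simp add: of_nat_diff)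
      then have "3 * int d - 9 \<le> \<delta>" using L by (simp add: large_def)
      then show ?thesis using e q0 by linarith
    next
      case False
      have "s \<le> d - 4" using m' m d by linarith
      \<comment> \<open>The bound for \<open>d - 1\<close> in place of \<open>d\<close> gives
        \<open>q\<close> \<ge> \<open>s + d - 2\<close>, so that the total is at least
        \<open>m + s + d - 2 = 3 * d - 5\<close>.\<close>
      then have "int (d - 1) - 1 \<le> int s * int (d - 1 - s)"
        using False d by (intro complete_defect_ge) auto
      also have "int s * int (d - 1 - s) = q - int s"
        using \<open>s \<le> d - 4\<close> d by (simp add: q_def of_nat_diff algebra_simps)
      finally have "int d - 2 \<le> q - int s" using d by (simp add: of_nat_diff)
      then show ?thesis using e m m' by linarith
    qed
  qed
  then show ?thesis by (simp only: q_def)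
qed

text \<open>Adding components one at a time, either a copy of \<open>K\<^sub>d\<close> can be split off without
  increasing the defect, or all components seen so far amount to one small complete graph,
  or to one large component of fewer than \<open>2d\<close> vertices and one small complete graph.\<close>

definition profile :: "nat \<Rightarrow> nat \<Rightarrow> int \<Rightarrow> bool" where
  "profile d p x \<longleftrightarrow> (d \<le> p \<and> min_defect d (p - d) \<le> x) \<or>
     (p < d \<and> int p * int (d - p) \<le> x) \<or>
     (\<exists>m s \<delta>. p = m + s \<and> large d m \<delta> \<and> m < 2 * d \<and> s < d \<and> \<delta> + int s * int (d - s) \<le> x)"

lemma profile_splitI:
  assumes "d \<ge> 5" "min_defect d a \<le> x" "min_defect d b \<le> y" "p = a + b + d" "x + y \<le> z"
  shows "profile d p z"
  using min_defect_add[OF assms(1), of a b] assms(2-5) unfolding profile_def by auto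

lemma profile_cases [consumes 1, case_names split small mixed]:
  assumes "profile d p x"
  obtains a where "p = a + d" "min_defect d a \<le> x"
  | "p < d" "int p * int (d - p) \<le> x"
  | m s \<delta> where "p = m + s" "large d m \<delta>" "m < 2 * d" "s < d" "\<delta> + int s * int (d - s) \<le> x"
  using assms unfolding profile_def by (metis le_add_diff_inverse2)

text \<open>Unless K_d is already split off, the new part is added to the small complete graph,
  which either stays below \<open>d\<close> vertices or overflows and releases a K_d.\<close>

lemma profile_add_small:
  assumes d: "d \<ge> 5" and P: "profile d p x" and t: "t \<le> d" "int t * int (d - t) \<le> y"
  shows "profile d (p + t) (x + y)"
proof -
  have mt: "min_defect d t \<le> y" using min_defect_small[OF d t(1)] t(2) by linarith
  from P show ?thesis
  proof (cases rule: profile_cases)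
    case (split a)
    then show ?thesis using mt by (intro profile_splitI[OF d, of a x t y]) auto
  next
    case small
    show ?thesis
    proof (cases "p + t < d")
      case True
      then show ?thesis
        using complete_defect_merge[of p t d] small t unfolding profile_def by auto
    next
      case False
      then have "min_defect d (p + t - d) \<le> x + y"
        using min_defect_overflow[OF d, of p t] small t by linarith
      then show ?thesis using False unfolding profile_def by auto
    qed
  next
    case (mixed m s \<delta>)
    show ?thesis
    proof (cases "s + t < d")
      case True
      have "\<delta> + int (s + t) * int (d - (s + t)) \<le> x + y"
        using complete_defect_merge[of s t d] True mixed t by linarith
      moreover have "p + t = m + (s + t)" using mixed by simp
      ultimately show ?thesis
        unfolding profile_def using mixed True by blast
    next
      case False
      then have "min_defect d (s + t - d) \<le> int s * int (d - s) + int t * int (d - t)"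
        using mixed t by (intro min_defect_overflow d) auto
      moreover have "min_defect d m \<le> \<delta>" using mixed by (simp add: large_def)
      ultimately show ?thesis
        by (rule profile_splitI[OF d]) (use mixed t False in auto)
    qed
  qed
qed

text \<open>A component with at least \<open>2 * d\<close> vertices releases a K_d by itself, and
  two shorter large ones do so together. Next to a small complete graph alone, a shorter one gives
  the mixed form.\<close>

lemma profile_add_large:
  assumes d: "d \<ge> 5" and P: "profile d p x" and L: "large d l y"
  shows "profile d (p + l) (x + y)"
proof -
  have l: "d < l" "int l \<le> y" "min_defect d l \<le> y" using L by (simp_all add: large_def)
  have huge: "profile d (p + l) (x + y)" if "2 * d \<le> l" "min_defect d p \<le> x"
  proof -
    have "min_defect d (l - d) \<le> y" using L that by (simp add: large_def)
    with that(2) show ?thesis by (rule profile_splitI[OF d]) (use l in auto)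
  qed
  from P show ?thesis
  proof (cases rule: profile_cases)
    case (split a)
    from split(2) l(3) show ?thesis
      by (rule profile_splitI[OF d]) (use split in auto)
  next
    case small
    show ?thesis
    proof (cases "l < 2 * d")
      case True
      moreover have "p + l = l + p" "y + int p * int (d - p) \<le> x + y" using small by simp_all
      ultimately show ?thesis using small(1) L unfolding profile_def by blast
    next
      case False
      then show ?thesis using huge min_defect_small[OF d, of p] small by simp
    qed
  next
    case (mixed m s \<delta>)
    have m: "d < m" "int m \<le> \<delta>" "min_defect d m \<le> \<delta>" using mixed by (simp_all add: large_def)
    have ms: "min_defect d s \<le> int s * int (d - s)" using mixed by (intro min_defect_small d) auto
    show ?thesis
    proof (cases "l < 2 * d")
      case True
      have "min_defect d (m + l - d) \<le> int m + int l"
        using mixed m l True by (intro min_defect_two_large d) auto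
      then show ?thesis using ms
        by (rule profile_splitI[OF d]) (use mixed m l in auto)
    next
      case False
      have "min_defect d p \<le> x"
        using min_defect_add[OF d, of m s] m ms mixed by simp
      then show ?thesis using huge False by simp
    qed
  qed
qed

text \<open>Components are peeled off one at a time. One with at most \<open>d\<close> vertices has
  at least the defect of the complete graph of its size; any other is \<open>large\<close>.\<close>

lemma profile_defect:
  assumes "finite V" and sym: "symp E" and irr: "irreflp E" and "spider_free d V E" and d: "d \<ge> 5"
  shows "profile d (card V) (defect d V E)"
  using assms(1,4)
proof (induction "card V" arbitrary: V rule: less_induct)
  case less
  show ?case
  proof (cases "V = {}")
    case True
    then show ?thesis using d by (simp add: profile_def defect_def)
  next
    case False
    obtain C where C: "C \<subseteq> V" "C \<noteq> {}" "connected_on C E" "\<And>v. v \<in> C \<Longrightarrow> nbrs V E v \<subseteq> C"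
      using connected_on_component[OF less.prems(1) False] by blast
    define U where "U = V - C"
    have fin: "finite C" "finite U" using finite_subset[OF C(1) less.prems(1)] less.prems(1) by (simp_all add: U_def)
    have card: "card V = card U + card C"
      using C fin card_Diff_subset[of C V] card_mono[OF less.prems(1) C(1)] by (simp add: U_def)
    moreover have "card C > 0" using fin C by (simp add: card_gt_0_iff)
    ultimately have IH: "profile d (card U) (defect d U E)"
      using less.prems fin spider_free_mono[of d V E U]
      by (intro less.hyps) (auto simp: U_def)
    have nC: "nbrs V E v = nbrs C E v" if "v \<in> C" for v
      using C(1) C(4)[OF that] by (auto simp: nbrs_def)
    have "\<not> E v w" if "v \<in> U" "w \<in> C" for v w
      using C(4)[OF that(2)] that sympD[OF sym, of v w] by (auto simp: U_def nbrs_def)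
    then have nU: "nbrs V E v = nbrs U E v" if "v \<in> U" for v
      using that by (auto simp: U_def nbrs_def)
    have "defect d V E = defect d U E + defect d C E"
      unfolding defect_def U_def
      using sum.subset_diff[OF C(1) less.prems(1), of "\<lambda>v. int d - 1 - int (card (nbrs V E v))"]
        nC nU by (simp add: U_def)
    moreover have "profile d (card U + card C) (defect d U E + defect d C E)"
    proof (cases "card C \<le> d")
      case True
      have "(\<Sum>v\<in>C. int (d - card C)) \<le> defect d C E"
        unfolding defect_def
      proof (rule sum_mono)
        fix v assume v: "v \<in> C"
        have "nbrs C E v \<subseteq> C - {v}" using irreflpD[OF irr] by auto
        then have "card (nbrs C E v) \<le> card (C - {v})" using fin by (intro card_mono) auto
        also have "\<dots> < card C" using v fin by (intro psubset_card_mono) auto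
        finally show "int (d - card C) \<le> int d - 1 - int (card (nbrs C E v))" using True by linarith
      qed
      then show ?thesis using profile_add_small[OF d IH True] by simp
    next
      case False
      then show ?thesis
        using large_connected[OF fin(1) sym irr C(3) spider_free_mono[OF less.prems(2) C(1) less.prems(1)] _ d]
        by (intro profile_add_large[OF d IH]) auto
    qed
    ultimately show ?thesis using card by simp
  qed
qed

section \<open>Periodicity and the base values\<close>

lemma min_defect_profile:
  assumes "d \<ge> 5"
  shows "profile d p (min_defect d p)"
proof -
  obtain V :: "nat set" and E where "finite V" "card V = p" "symp E" "irreflp E" "spider_free d V E"
      "defect d V E = min_defect d p"
    using min_defect_attained[OF assms] by blast
  then show ?thesis using profile_defect[of V E d] assms by simp
qed

text \<open>On \<open>q + d\<close> \<ge> \<open>2 * d\<close> vertices an extremal graph either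
  splits off K_d or is mixed, and the mixed form can be exchanged for K_d and a graph on
  \<open>q\<close> vertices.\<close>

lemma min_defect_periodic:
  assumes d: "d \<ge> 5" and q: "d \<le> q"
  shows "min_defect d (q + d) = min_defect d q"
proof (rule antisym[OF min_defect_antimono[OF d]])
  from min_defect_profile[OF d, of "q + d"] show "min_defect d q \<le> min_defect d (q + d)"
  proof (cases rule: profile_cases)
    case (mixed m s \<delta>)
    then have "min_defect d (m + s - d) \<le> \<delta> + int s * int (d - s)"
      using q by (intro min_defect_large_small d) auto
    moreover have "m + s - d = q" using mixed by simp
    ultimately show ?thesis using mixed by simp
  qed auto
qed

lemma min_defect_periodic_mult:
  assumes "d \<ge> 5" and "k \<ge> 1"
  shows "min_defect d (k * d + r) = min_defect d (d + r)"
  using assms(2)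
proof (induction k rule: dec_induct)
  case (step k)
  have "d \<le> k * d + r" using step by (simp add: trans_le_add1)
  then show ?case
    using min_defect_periodic[OF assms(1), of "k * d + r"] step by (simp add: ac_simps)
qed simp

lemma min_defect_complete:
  assumes d: "d \<ge> 5" and r: "r \<le> d"
  shows "min_defect d r = int r * int (d - r)"
proof (rule antisym[OF min_defect_small[OF d r]])
  obtain V :: "nat set" and E where V: "finite V" "card V = r" "symp E" "irreflp E"
      "spider_free d V E" "defect d V E = min_defect d r"
    using min_defect_attained[OF d] by blast
  have "(\<Sum>v\<in>V. int (d - r)) \<le> defect d V E"
    unfolding defect_def
  proof (rule sum_mono)
    fix v assume v: "v \<in> V"
    have "nbrs V E v \<subseteq> V - {v}" using irreflpD[OF V(4)] by auto
    then have "card (nbrs V E v) \<le> card (V - {v})" using V(1) by (intro card_mono) auto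
    also have "\<dots> < card V" using v V(1) by (intro psubset_card_mono) auto
    finally show "int (d - r) \<le> int d - 1 - int (card (nbrs V E v))" using r V(2) by linarith
  qed
  then show "int r * int (d - r) \<le> min_defect d r" using V(2,6) by simp
qed

text \<open>K_d together with K_r attains the value. Conversely, splitting off K_d leaves
  \<open>r\<close> vertices, where K_r is optimal, and the mixed form is no better by
  \<open>large_small_base\<close>.\<close>

lemma min_defect_base:
  assumes d: "d \<ge> 5" and r: "r \<in> {0, d - 3, d - 2, d - 1}"
  shows "min_defect d (d + r) = int r * int (d - r)"
proof (cases "r = 0")
  case True
  then show ?thesis using min_defect_complete[OF d, of d] by simp
next
  case False
  then have r': "r \<in> {d - 3, d - 2, d - 1}" "r \<le> d" using r d by auto
  have h: "min_defect d r = int r * int (d - r)" by (rule min_defect_complete[OF d r'(2)])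
  show ?thesis
  proof (rule antisym)
    show "min_defect d (d + r) \<le> int r * int (d - r)"
      using min_defect_antimono[OF d, of r] h by (simp add: add.commute)
    from min_defect_profile[OF d, of "d + r"] show "int r * int (d - r) \<le> min_defect d (d + r)"
    proof (cases rule: profile_cases)
      case (split a)
      then show ?thesis using h by simp
    next
      case (mixed m s \<delta>)
      then have "int r * int (d - r) \<le> \<delta> + int s * int (d - s)"
        using large_small_base[OF d _ _ r'(1), of m \<delta> s] by simp
      then show ?thesis using mixed by simp
    qed simp
  qed
qed

theorem theorem4p1:
  fixes p n k r :: nat
  assumes "p \<ge> n - 1" and "n - 1 \<ge> 5"
    and "k \<ge> 1" and "r \<in> {0..n - 2}" and "p = k * (n - 1) + r"
  shows "(1 \<le> r \<and> r \<le> n - 5 \<longrightarrow>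
            real (ex p (T_star n)) =
              (real k - 1) * (real n - 1) * (real n - 2) / 2 + real (ex (n - 1 + r) (T_star n))) \<and>
         (r \<in> {0, n - 4, n - 3, n - 2} \<longrightarrow>
            real (ex p (T_star n)) =
              ((real n - 2) * real p - real r * (real n - 1 - real r)) / 2)"
proof -
  define d where "d = n - 1"
  have d: "d \<ge> 5" and n: "n = d + 1" using assms(2) by (auto simp: d_def)
  have p: "p = k * d + r" using assms(5) by (simp add: d_def)
  have ex_eq: "2 * real (ex q (T_star n)) = (real d - 1) * real q - real_of_int (min_defect d q)" for q
    unfolding min_defect_def n by simp
  \<comment> \<open>Equal defects on \<open>k * d + r\<close> and \<open>d + r\<close> vertices mean
    that the edge numbers differ by those of \<open>k - 1\<close> copies of K_d.\<close>
  have per: "min_defect d p = min_defect d (d + r)"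
    unfolding p by (rule min_defect_periodic_mult[OF d assms(3)])
  show ?thesis
  proof (intro conjI impI)
    show "real (ex p (T_star n)) =
        (real k - 1) * (real n - 1) * (real n - 2) / 2 + real (ex (n - 1 + r) (T_star n))"
      using ex_eq[of p] ex_eq[of "d + r"] per
      by (simp add: n p field_simps)
    assume "r \<in> {0, n - 4, n - 3, n - 2}"
    then have r: "r \<in> {0, d - 3, d - 2, d - 1}" by (simp add: n)
    then have "r \<le> d" by auto
    then have "real_of_int (min_defect d p) = real r * (real d - real r)"
      using per min_defect_base[OF d r] by (simp add: of_nat_diff)
    then show "real (ex p (T_star n)) =
        ((real n - 2) * real p - real r * (real n - 1 - real r)) / 2"
      using ex_eq[of p] by (simp add: n field_simps)
  qed
qed

end
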